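(* Let $\sigma \in \mathbb{S}^{N-1}$ and $y \in \mathbb{R}^N$. Then, $$R^N K_0(R\sigma - y) \underset{R\to+\infty}{\longrightarrow} \frac{\Gamma(\frac{N}{2})}{2\pi^{\frac{N}{2}}} (1 - N\sigma_1^2).$$
   Context: $N \geq 2$ is an integer. The Fourier transform convention is $\widehat{f}(\xi) = \int_{\mathbb{R}^N} f(x) e^{-ix\cdot\xi}\,dx$. $K_0$ is the tempered distribution on $\mathbb{R}^N$ with Fourier transform $$\widehat{K_0}(\xi) = \frac{\xi_1^2}{|\xi|^2+\xi_1^4};$$ its restriction to $\mathbb{R}^N\setminus\{0\}$ is a continuous function, whose values are denoted $K_0(x)$. *)

theory Defs
  imports "HOL-Analysis.Analysis"
begin

definition partial_deriv :: "'n::finite \<Rightarrow> (real^'n \<Rightarrow> complex) \<Rightarrow> real^'n \<Rightarrow> complex" where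
  "partial_deriv i f x = frechet_derivative f (at x) (axis i 1)"

text \<open>A list of indices plays the role of a multi-index (without identifying permuted lists).\<close>

definition iter_partial :: "'n::finite list \<Rightarrow> (real^'n \<Rightarrow> complex) \<Rightarrow> real^'n \<Rightarrow> complex" where
  "iter_partial is f = foldr partial_deriv is f"

definition smooth :: "(real^'n::finite \<Rightarrow> complex) \<Rightarrow> bool" where
  "smooth f \<longleftrightarrow> (\<forall>is x. iter_partial is f differentiable (at x))"

definition schwartz_space :: "(real^'n::finite \<Rightarrow> complex) set" where
  "schwartz_space = {f. smooth f \<and>
     (\<forall>k is. bdd_above (range (\<lambda>x. (1 + norm x) ^ k * norm (iter_partial is f x))))}"

definition schwartz_seminorm :: "nat \<Rightarrow> 'n::finite list \<Rightarrow> (real^'n \<Rightarrow> complex) \<Rightarrow> real" where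
  "schwartz_seminorm k is f = (SUP x. (1 + norm x) ^ k * norm (iter_partial is f x))"

text \<open>Functionals are total on all functions; only their values on \<^const>\<open>schwartz_space\<close> matter.
  Continuity is expressed by domination by finitely many of the defining seminorms.\<close>

definition tempered_distribution :: "((real^'n::finite \<Rightarrow> complex) \<Rightarrow> complex) \<Rightarrow> bool" where
  "tempered_distribution T \<longleftrightarrow>
     (\<forall>f\<in>schwartz_space. \<forall>g\<in>schwartz_space. T (\<lambda>x. f x + g x) = T f + T g) \<and>
     (\<forall>c. \<forall>f\<in>schwartz_space. T (\<lambda>x. c * f x) = c * T f) \<and>
     (\<exists>C m. \<forall>f\<in>schwartz_space.
        norm (T f) \<le> C * (\<Sum>is | length is \<le> m. schwartz_seminorm m is f))"

definition fourier :: "(real^'n::finite \<Rightarrow> complex) \<Rightarrow> real^'n \<Rightarrow> complex" where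
  "fourier f \<xi> = (LINT x|lborel. f x * exp (- \<i> * complex_of_real (x \<bullet> \<xi>)))"

definition distr_fourier ::
    "((real^'n::finite \<Rightarrow> complex) \<Rightarrow> complex) \<Rightarrow> (real^'n \<Rightarrow> complex) \<Rightarrow> complex" where
  "distr_fourier T f = T (fourier f)"

definition regular_distr ::
    "(real^'n::finite \<Rightarrow> complex) \<Rightarrow> (real^'n \<Rightarrow> complex) \<Rightarrow> complex" where
  "regular_distr g f = (LINT x|lborel. g x * f x)"

definition test_functions :: "(real^'n::finite) set \<Rightarrow> (real^'n \<Rightarrow> complex) set" where
  "test_functions U = {f. smooth f \<and> compact (closure {x. f x \<noteq> 0}) \<and> closure {x. f x \<noteq> 0} \<subseteq> U}"

text \<open>The restriction of \<open>T\<close> to the open set \<open>U\<close> is the continuous function \<open>K\<close>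
  (values of \<open>K\<close> outside \<open>U\<close> are irrelevant).\<close>

definition restricts_to_continuous ::
    "((real^'n::finite \<Rightarrow> complex) \<Rightarrow> complex) \<Rightarrow> (real^'n) set \<Rightarrow> (real^'n \<Rightarrow> complex) \<Rightarrow> bool" where
  "restricts_to_continuous T U K \<longleftrightarrow>
     continuous_on U K \<and> (\<forall>f\<in>test_functions U. T f = regular_distr K f)"

text \<open>The index type \<open>'n\<close> is unordered; \<open>one\<close> is the index that is labelled 1.
  At the origin the value is 0 by the convention on division, which is a null set.\<close>

definition K0_hat :: "'n::finite \<Rightarrow> real^'n \<Rightarrow> real" where
  "K0_hat one \<xi> = (\<xi> $ one)\<^sup>2 / ((norm \<xi>)\<^sup>2 + (\<xi> $ one) ^ 4)"

end

theory Submission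
  imports Defs "HOL-Probability.Probability" "HOL-Real_Asymp.Real_Asymp"
begin

text \<open>The multiplier is a superposition of Gaussian-type multipliers that factor over the coordinates:
  since $1/A = \int_0^\infty e^{-tA}\,dt$,
  \[ \frac{\xi_1^2}{|\xi|^2+\xi_1^4}
     = \int_0^\infty \xi_1^2 e^{-t(|\xi|^2+\xi_1^4)}\,dt, \]
  and for fixed $t$ the inverse Fourier transform of the integrand, the heat slice $P_{t,1}(x)$, is a
  product of one-dimensional integrals: heat kernels in the variables other than $x_1$, and in $x_1$
  the integral \<open>osc_integral\<close> with a quartic term in the exponent. More generally $P_{t,e}$ denotes
  the slice in which $\xi_1^4$ carries the coefficient $e \in [0,1]$.

  Everything rests on one estimate, \<open>heat_slice_bound\<close>: on the set where some coordinate satisfies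
  $|x_i| \ge c$ one has $|P_{t,e}(x)| \le C/(1+t^2)$, with $C$ independent of $t > 0$ and
  $e \in [0,1]$. For large $t$ it is the trivial bound by the integral of the modulus. For small $t$ a
  coordinate $i \ne 1$ contributes the factor $e^{-c^2/4t}$, whereas in the first coordinate
  repeated integration by parts is needed, after scaling the exponent to a normal form
  (\<open>osc_integral_decay_normalised\<close>).

  This estimate is used twice. Firstly, $K_0(x) = \int_0^\infty P_{t,1}(x)\,dt$ for every $x \ne 0$
  (\<open>K0_eq_integral_heat_slice\<close>): both sides have the same pairing with products of bumps of one
  variable supported off the origin, and letting the bumps shrink to a point recovers the values, on
  the left by continuity of $K_0$ and on the right by dominated convergence. Such a product is the
  Fourier transform of a Schwartz function, by Fourier inversion on the line (\<open>wave_inversion\<close>),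
  so the hypothesis on the transform of the distribution applies to it. Secondly, the substitution
  $t = R^2\tau$ gives
  \[ R^N K_0(R\sigma - y) = \int_0^\infty P_{\tau,1/R^2}(\sigma - y/R)\,d\tau, \]
  in which the quartic term fades as $R$ grows. Dominated convergence leaves
  $\int_0^\infty P_{\tau,0}(\sigma)\,d\tau$, where $P_{\tau,0}$ is minus the second derivative in
  direction $1$ of the heat kernel; this integral is elementary in terms of the Gamma function and
  gives the claimed limit (\<open>integral_heat_slice_0\<close>).\<close>

section \<open>Gaussian-damped oscillatory integrals on the line\<close>

definition damped_power :: "nat \<Rightarrow> real \<Rightarrow> real \<Rightarrow> real \<Rightarrow> real" where
  "damped_power n a b s = s ^ n * exp (- (a * s\<^sup>2) - b * s ^ 4)"

definition osc_integral :: "nat \<Rightarrow> real \<Rightarrow> real \<Rightarrow> real \<Rightarrow> complex" where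
  "osc_integral n a b z = (CLINT s|lborel. complex_of_real (damped_power n a b s) * iexp (s * z))"

lemma measurable_damped_power [measurable (raw)]:
  assumes [measurable]: "a \<in> borel_measurable M" "b \<in> borel_measurable M" "s \<in> borel_measurable M"
  shows "(\<lambda>x. damped_power n (a x) (b x) (s x)) \<in> borel_measurable M"
  unfolding damped_power_def by measurable

text \<open>Rescaling turns these into moments of the standard normal distribution.\<close>
lemma integrable_damped_power_gauss:
  assumes a: "a > 0"
  shows "integrable lborel (damped_power n a 0)"
proof -
  have 1: "integrable lborel (\<lambda>x::real. std_normal_density x * x ^ n)"
    by (rule integrable_std_normal_moment)
  define c where "c = sqrt (2 * a)"
  have c: "c > 0" "c\<^sup>2 = 2 * a" using a by (auto simp: c_def)
  from lborel_integrable_real_affine[OF 1, of c 0] c(1)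
  have "integrable lborel (\<lambda>x. std_normal_density (c * x) * (c * x) ^ n)" by simp
  then have "integrable lborel (\<lambda>x. (sqrt (2 * pi) / c ^ n) * (std_normal_density (c * x) * (c * x) ^ n))"
    by (rule integrable_mult_right)
  also have "(\<lambda>x. (sqrt (2 * pi) / c ^ n) * (std_normal_density (c * x) * (c * x) ^ n)) = damped_power n a 0"
    using c by (auto simp: fun_eq_iff damped_power_def std_normal_density_def power_mult_distrib)
  finally show ?thesis .
qed

lemma abs_damped_power_le:
  assumes "a' \<le> a" "b' \<le> b"
  shows "\<bar>damped_power n a b s\<bar> \<le> \<bar>damped_power n a' b' s\<bar>"
  unfolding damped_power_def abs_mult
  by (intro mult_left_mono)
     (use mult_right_mono[OF assms(1), of "s\<^sup>2"] mult_right_mono[OF assms(2), of "s ^ 4"] in auto)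

lemma integrable_damped_power:
  assumes a: "a > 0" "b \<ge> 0"
  shows "integrable lborel (damped_power n a b)"
  by (rule Bochner_Integration.integrable_bound[OF integrable_damped_power_gauss[OF a(1), of n]])
     (use abs_damped_power_le[of a a 0 b] a in \<open>auto\<close>)

lemma integrable_damped_power_iexp:
  assumes a: "a > 0" "b \<ge> 0"
  shows "complex_integrable lborel (\<lambda>s. complex_of_real (damped_power n a b s) * iexp (s * z))"
  by (rule Bochner_Integration.integrable_bound[OF integrable_damped_power[OF a, of n]])
     (auto simp: norm_mult norm_exp_i_times)

lemma norm_osc_integral_le:
  assumes a: "a > 0" "b \<ge> 0"
  shows "norm (osc_integral n a b z) \<le> (LINT s|lborel. \<bar>damped_power n a b s\<bar>)"
  unfolding osc_integral_def
  by (rule order_trans[OF integral_norm_bound]) (simp add: norm_mult)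

lemma osc_integral_scale:
  assumes l: "l > 0"
  shows "osc_integral n a b z = complex_of_real (l ^ Suc n) * osc_integral n (a * l\<^sup>2) (b * l ^ 4) (l * z)"
proof -
  have "osc_integral n a b z = l *\<^sub>R (CLINT s|lborel. complex_of_real (damped_power n a b (0 + l * s)) * iexp ((0 + l * s) * z))"
    unfolding osc_integral_def using l by (subst lborel_integral_real_affine[of l _ 0]) auto
  also have "(\<lambda>s. complex_of_real (damped_power n a b (0 + l * s)) * iexp ((0 + l * s) * z)) =
     (\<lambda>s. complex_of_real (l ^ n) * (complex_of_real (damped_power n (a * l\<^sup>2) (b * l ^ 4) s) * iexp (s * (l * z))))"
    by (auto simp: damped_power_def fun_eq_iff power_mult_distrib algebra_simps)
  finally show ?thesis by (simp add: osc_integral_def scaleR_conv_of_real)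
qed

lemma integral_derivative_eq_0:
  fixes F f :: "real \<Rightarrow> complex"
  assumes "\<And>s. (F has_vector_derivative f s) (at s)" "\<And>s. isCont f s" "integrable lborel f"
    and "(F \<longlongrightarrow> 0) at_bot" "(F \<longlongrightarrow> 0) at_top"
  shows "integral\<^sup>L lborel f = 0"
proof -
  have "(LBINT x=-\<infinity>..\<infinity>. f x) = 0 - 0"
    by (rule interval_integral_FTC_integrable[where F=F])
       (use assms in \<open>auto simp: set_integrable_def ereal_tendsto_simps\<close>)
  then show ?thesis
    by (simp add: interval_lebesgue_integral_def set_lebesgue_integral_def)
qed

lemma has_vector_derivative_iexp_mult:
  "((\<lambda>s. iexp (s * z)) has_vector_derivative \<i> * z * iexp (s * z)) (at s)"
proof -
  have "((\<lambda>s. s * z) has_vector_derivative z) (at s)"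
    by (auto intro!: derivative_eq_intros)
  from vector_diff_chain_at[OF this has_vector_derivative_iexp]
  show ?thesis by (simp add: comp_def scaleR_conv_of_real mult.assoc mult.left_commute)
qed

text \<open>The boundary terms vanish because of the Gaussian factor. This recursion trades a factor $z$ for
  other integrals of the same family; it serves both for the decay in $z$ and, with $b = 0$, for
  computing second moments.\<close>
lemma osc_integral_by_parts:
  assumes a: "a > 0" "b \<ge> 0"
  shows "\<i> * z * osc_integral n a b z =
    2 * a * osc_integral (Suc n) a b z + 4 * b * osc_integral (n + 3) a b z - n * osc_integral (n - 1) a b z"
proof -
  define F where "F s = complex_of_real (damped_power n a b s) * iexp (s * z)" for s
  define f where "f s = n * (complex_of_real (damped_power (n-1) a b s) * iexp (s * z))
     - 2 * a * (complex_of_real (damped_power (Suc n) a b s) * iexp (s * z))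
     - 4 * b * (complex_of_real (damped_power (n + 3) a b s) * iexp (s * z))
     + \<i> * z * (complex_of_real (damped_power n a b s) * iexp (s * z))" for s
  have intf: "complex_integrable lborel f"
    unfolding f_def by (intro Bochner_Integration.integrable_add Bochner_Integration.integrable_diff
      integrable_mult_right integrable_damped_power_iexp a)
  have e4: "((\<lambda>s::real. s ^ 4) has_real_derivative 4 * s ^ 3) (at s)" for s
    by (auto intro!: derivative_eq_intros)
  have dm: "(damped_power n a b has_real_derivative (n * damped_power (n-1) a b s - 2 * a * damped_power (Suc n) a b s - 4 * b * damped_power (n+3) a b s)) (at s)" for s
    unfolding damped_power_def
    by (rule derivative_eq_intros e4 refl | simp)+ (simp add: algebra_simps power_add power3_eq_cube)
  have dF: "(F has_vector_derivative f s) (at s)" for s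
  proof -
    have "((\<lambda>s. complex_of_real (damped_power n a b s)) has_vector_derivative
        complex_of_real (n * damped_power (n-1) a b s - 2 * a * damped_power (Suc n) a b s - 4 * b * damped_power (n+3) a b s)) (at s)"
      by (intro has_vector_derivative_of_real) (use dm[of s] in \<open>simp add: has_real_derivative_iff_has_vector_derivative\<close>)
    moreover have "((\<lambda>s. iexp (s * z)) has_vector_derivative \<i> * z * iexp (s * z)) (at s)"
      by (rule has_vector_derivative_iexp_mult)
    ultimately show ?thesis unfolding F_def f_def
      by (rule has_vector_derivative_eq_rhs[OF has_vector_derivative_mult]) (simp add: algebra_simps)
  qed
  have contf: "isCont f s" for s
  proof -
    have "continuous_on UNIV f"
      unfolding f_def damped_power_def by (intro continuous_intros)
    then show ?thesis by (simp add: continuous_on_eq_continuous_at)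
  qed
  have lim: "((\<lambda>s. s ^ n * exp (- (a * s\<^sup>2))) \<longlongrightarrow> 0) at_top" "((\<lambda>s. s ^ n * exp (- (a * s\<^sup>2))) \<longlongrightarrow> 0) at_bot" 
    using a by real_asymp+
  have nF: "norm (F s) \<le> norm (s ^ n * exp (- (a * s\<^sup>2)))" for s
    using abs_damped_power_le[of a a 0 b n s] a by (simp add: F_def norm_mult) (simp add: damped_power_def)
  have "(F \<longlongrightarrow> 0) at_top"
    by (rule Lim_null_comparison[OF _ tendsto_norm_zero[OF lim(1)]]) (use nF in auto)
  moreover have "(F \<longlongrightarrow> 0) at_bot"
    by (rule Lim_null_comparison[OF _ tendsto_norm_zero[OF lim(2)]]) (use nF in auto)
  ultimately have "integral\<^sup>L lborel f = 0"
    by (intro integral_derivative_eq_0[OF dF contf intf])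
  moreover have "integral\<^sup>L lborel f = n * osc_integral (n - 1) a b z - 2 * a * osc_integral (Suc n) a b z
      - 4 * b * osc_integral (n + 3) a b z + \<i> * z * osc_integral n a b z"
    unfolding f_def osc_integral_def
    by (simp add: integrable_damped_power_iexp a del: of_real_mult)
  ultimately show ?thesis by (simp add: algebra_simps)
qed

text \<open>Either normalisation forces $-as^2-bs^4 \le 1-s^2$, so all integrals without a power of $z$ are bounded
  uniformly in $a$ and $b$. Each integration by parts then gains one power of $z$ at the cost of
  integrals with other exponents $n$ and coefficients that stay bounded since $a, b \le 1$; hence
  the induction is over $k$ for all $n$ simultaneously.\<close>
lemma osc_integral_decay_normalised:
  "\<exists>C. \<forall>a b z. 0 < a \<and> a \<le> 1 \<and> 0 \<le> b \<and> b \<le> 1 \<and> (a = 1 \<or> b = 1) \<longrightarrow> \<bar>z\<bar> ^ k * norm (osc_integral n a b z) \<le> C"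
proof (induction k arbitrary: n)
  case 0
  have "norm (osc_integral n a b z) \<le> exp 1 * (LINT s|lborel. \<bar>damped_power n 1 0 s\<bar>)"
    if h: "0 < a" "0 \<le> b" "a = 1 \<or> b = 1" for a b z
  proof -
    have "norm (osc_integral n a b z) \<le> (LINT s|lborel. \<bar>damped_power n a b s\<bar>)"
      by (rule norm_osc_integral_le) (use h in auto)
    also have "\<dots> \<le> (LINT s|lborel. exp 1 * \<bar>damped_power n 1 0 s\<bar>)"
    proof (rule integral_mono)
      show "integrable lborel (\<lambda>s. \<bar>damped_power n a b s\<bar>)" "integrable lborel (\<lambda>s. exp 1 * \<bar>damped_power n 1 0 s\<bar>)"
        using h by (auto intro!: integrable_damped_power integrable_mult_right integrable_abs)
      fix s :: real
      have "- (a * s\<^sup>2) - b * s ^ 4 \<le> 1 + - s\<^sup>2"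
        using h(3)
      proof
        assume "a = 1"
        moreover have "0 \<le> b * s ^ 4" using h by simp
        ultimately show ?thesis by simp
      next
        assume "b = 1"
        moreover have "s\<^sup>2 \<le> 1 + s ^ 4"
          using zero_le_power2[of "s\<^sup>2 - 1 / 2"] by (simp add: power2_eq_square algebra_simps power4_eq_xxxx)
        moreover have "0 \<le> a * s\<^sup>2" using h by simp
        ultimately show ?thesis by simp
      qed
      then have "exp (- (a * s\<^sup>2) - b * s ^ 4) \<le> exp 1 * exp (- s\<^sup>2)"
        by (simp flip: exp_add)
      then show "\<bar>damped_power n a b s\<bar> \<le> exp 1 * \<bar>damped_power n 1 0 s\<bar>"
        unfolding damped_power_def abs_mult
          using mult_left_mono[of _ _ "\<bar>s ^ n\<bar>"] by (fastforce simp: mult.left_commute)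
    qed
    finally show ?thesis by simp
  qed
  then show ?case by (intro exI[of _ "exp 1 * (LINT s|lborel. \<bar>damped_power n 1 0 s\<bar>)"]) auto
next
  case (Suc k)
  obtain C1 where C1: "\<And>a b z. 0 < a \<and> a \<le> 1 \<and> 0 \<le> b \<and> b \<le> 1 \<and> (a = 1 \<or> b = 1) \<Longrightarrow> \<bar>z\<bar> ^ k * norm (osc_integral (Suc n) a b z) \<le> C1"
    using Suc[of "Suc n"] by blast
  obtain C3 where C3: "\<And>a b z. 0 < a \<and> a \<le> 1 \<and> 0 \<le> b \<and> b \<le> 1 \<and> (a = 1 \<or> b = 1) \<Longrightarrow> \<bar>z\<bar> ^ k * norm (osc_integral (n + 3) a b z) \<le> C3"
    using Suc[of "n + 3"] by blast
  obtain C0 where C0: "\<And>a b z. 0 < a \<and> a \<le> 1 \<and> 0 \<le> b \<and> b \<le> 1 \<and> (a = 1 \<or> b = 1) \<Longrightarrow> \<bar>z\<bar> ^ k * norm (osc_integral (n - 1) a b z) \<le> C0"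
    using Suc[of "n - 1"] by blast
  have "\<bar>z\<bar> ^ Suc k * norm (osc_integral n a b z) \<le> 2 * C1 + 4 * C3 + n * C0"
    if h: "0 < a \<and> a \<le> 1 \<and> 0 \<le> b \<and> b \<le> 1 \<and> (a = 1 \<or> b = 1)" for a b z
  proof -
    have "\<bar>z\<bar> * norm (osc_integral n a b z) = norm (\<i> * z * osc_integral n a b z)" by (simp add: norm_mult)
    also have "\<dots> = norm (2 * a * osc_integral (Suc n) a b z + 4 * b * osc_integral (n + 3) a b z - n * osc_integral (n - 1) a b z)"
      using h by (subst osc_integral_by_parts) auto
    also have "\<dots> \<le> norm (2 * a * osc_integral (Suc n) a b z) + norm (4 * b * osc_integral (n + 3) a b z) + norm (n * osc_integral (n - 1) a b z)"
      by (meson add_mono norm_triangle_ineq norm_triangle_ineq4 order_refl order_trans)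
    also have "\<dots> \<le> 2 * norm (osc_integral (Suc n) a b z) + 4 * norm (osc_integral (n + 3) a b z) + n * norm (osc_integral (n - 1) a b z)"
      using h by (simp add: norm_mult mult_right_mono add_mono mult_left_le_one_le)
    finally have *: "\<bar>z\<bar> * norm (osc_integral n a b z) \<le> 2 * norm (osc_integral (Suc n) a b z) + 4 * norm (osc_integral (n + 3) a b z) + n * norm (osc_integral (n - 1) a b z)" .
    have "\<bar>z\<bar> ^ Suc k * norm (osc_integral n a b z) = \<bar>z\<bar> ^ k * (\<bar>z\<bar> * norm (osc_integral n a b z))" by simp
    also have "\<dots> \<le> \<bar>z\<bar> ^ k * (2 * norm (osc_integral (Suc n) a b z) + 4 * norm (osc_integral (n + 3) a b z) + n * norm (osc_integral (n - 1) a b z))"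
      by (rule mult_left_mono[OF *]) simp
    also have "\<dots> = 2 * (\<bar>z\<bar> ^ k * norm (osc_integral (Suc n) a b z)) + 4 * (\<bar>z\<bar> ^ k * norm (osc_integral (n + 3) a b z)) + n * (\<bar>z\<bar> ^ k * norm (osc_integral (n - 1) a b z))"
      by (simp add: algebra_simps)
    also have "\<dots> \<le> 2 * C1 + 4 * C3 + n * C0"
      by (intro add_mono mult_left_mono C1 C3 C0 h) auto
    finally show ?thesis .
  qed
  then show ?case by blast
qed

lemma osc_integral_tendsto:
  assumes a: "a > 0" and b: "\<And>k::nat. b k \<ge> 0" "b \<longlonglongrightarrow> b'" and z: "z \<longlonglongrightarrow> z'"
  shows "(\<lambda>k. osc_integral n a (b k) (z k)) \<longlonglongrightarrow> osc_integral n a b' z'"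
  unfolding osc_integral_def
proof (rule integral_dominated_convergence[where w="\<lambda>s. \<bar>damped_power n a 0 s\<bar>"])
  show "integrable lborel (\<lambda>s. \<bar>damped_power n a 0 s\<bar>)" using integrable_damped_power_gauss[OF a] by (rule integrable_abs)
  show "AE s in lborel. (\<lambda>k. complex_of_real (damped_power n a (b k) s) * iexp (s * z k)) \<longlonglongrightarrow> complex_of_real (damped_power n a b' s) * iexp (s * z')"
    unfolding damped_power_def by (intro AE_I2 tendsto_intros b z)
  show "AE s in lborel. norm (complex_of_real (damped_power n a (b k) s) * iexp (s * z k)) \<le> \<bar>damped_power n a 0 s\<bar>" for k
    using abs_damped_power_le[of a a 0 "b k"] b by (auto simp: norm_mult)
qed auto

text \<open>This is the characteristic function of the normal distribution, rescaled.\<close>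
lemma osc_integral_0_gauss:
  assumes a: "a > 0"
  shows "osc_integral 0 a 0 z = complex_of_real (sqrt (pi / a) * exp (- (z\<^sup>2 / (4 * a))))"
proof -
  define c where "c = sqrt (2 * a)"
  have c: "c > 0" "c\<^sup>2 = 2 * a" using a by (auto simp: c_def)
  have "exp (- ((z / c)\<^sup>2) / 2) = char std_normal_distribution (z / c)"
    by (simp add: char_std_normal_distribution)
  also have "\<dots> = (CLINT x|lborel. std_normal_density x *\<^sub>R iexp (z / c * x))"
    by (simp add: char_def integral_density)
  also have "\<dots> = c *\<^sub>R (CLINT x|lborel. std_normal_density (0 + c * x) *\<^sub>R iexp (z / c * (0 + c * x)))"
    using c by (subst lborel_integral_real_affine[of c _ 0]) auto
  also have "(\<lambda>x. std_normal_density (0 + c * x) *\<^sub>R iexp (z / c * (0 + c * x))) =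
     (\<lambda>x. (1 / sqrt (2 * pi)) *\<^sub>R (complex_of_real (damped_power 0 a 0 x) * iexp (x * z)))"
    using c by (auto simp: fun_eq_iff damped_power_def std_normal_density_def power_mult_distrib scaleR_conv_of_real algebra_simps)
  finally have "exp (- ((z / c)\<^sup>2) / 2) = (c / sqrt (2 * pi)) *\<^sub>R osc_integral 0 a 0 z"
    by (simp add: osc_integral_def)
  then have "osc_integral 0 a 0 z = complex_of_real ((sqrt (2 * pi) / c) * exp (- ((z / c)\<^sup>2) / 2))"
    using c(1) by (simp add: scaleR_conv_of_real field_simps)
  also have "sqrt (2 * pi) / c = sqrt (pi / a)"
    unfolding c_def by (simp add: real_sqrt_divide real_sqrt_mult)
  also have "- ((z / c)\<^sup>2) / 2 = - (z\<^sup>2 / (4 * a))"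
    using c by (simp add: power_divide)
  finally show ?thesis .
qed

text \<open>Two integrations by parts reduce the second moment to the Gaussian itself; equivalently this is
  minus the second derivative of the one-dimensional heat kernel, up to normalisation.\<close>
lemma osc_integral_2_gauss:
  assumes a: "a > 0"
  shows "osc_integral 2 a 0 z = complex_of_real (1 / (2 * a) - z\<^sup>2 / (4 * a\<^sup>2)) * osc_integral 0 a 0 z"
proof -
  have 1: "\<i> * z * osc_integral 0 a 0 z = 2 * a * osc_integral 1 a 0 z"
    using osc_integral_by_parts[of a 0 z 0] a by simp
  have 2: "\<i> * z * osc_integral 1 a 0 z = 2 * a * osc_integral 2 a 0 z - osc_integral 0 a 0 z"
    using osc_integral_by_parts[of a 0 z 1] a by (simp add: numeral_2_eq_2)
  have "4 * a\<^sup>2 * osc_integral 2 a 0 z = 2 * a * (2 * a * osc_integral 2 a 0 z - osc_integral 0 a 0 z) + 2 * a * osc_integral 0 a 0 z"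
    by (simp add: algebra_simps power2_eq_square)
  also have "2 * a * (2 * a * osc_integral 2 a 0 z - osc_integral 0 a 0 z) = \<i> * z * (2 * a * osc_integral 1 a 0 z)"
    unfolding 2[symmetric] by simp
  also have "\<dots> = - (z\<^sup>2 * osc_integral 0 a 0 z)"
    by (subst 1[symmetric]) (simp add: power2_eq_square algebra_simps)
  finally have "osc_integral 2 a 0 z = complex_of_real ((2 * a - z\<^sup>2) / (4 * a\<^sup>2)) * osc_integral 0 a 0 z"
    using a by (simp add: field_simps)
  also have "(2 * a - z\<^sup>2) / (4 * a\<^sup>2) = 1 / (2 * a) - z\<^sup>2 / (4 * a\<^sup>2)"
    using a by (simp add: field_simps power2_eq_square)
  finally show ?thesis .
qed

section \<open>Product integrals and approximate identities\<close>

lemma Basis_cart_eq: "(Basis :: (real^'n::finite) set) = range (\<lambda>i. axis i 1)"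
  by (auto simp: Basis_vec_def)

text \<open>Lebesgue measure on \<open>real^'n\<close> is the image of the product measure indexed by the basis
  vectors, so only a reindexing from basis vectors to components is needed.\<close>
lemma
  fixes f :: "'n::finite \<Rightarrow> real \<Rightarrow> complex"
  assumes f: "\<And>i. integrable lborel (f i)"
  shows integrable_prod_cart: "integrable lborel (\<lambda>x::real^'n. \<Prod>i\<in>UNIV. f i (x $ i))" (is ?A)
    and integral_prod_cart: "(LINT x|lborel. (\<Prod>i\<in>UNIV. f i ((x::real^'n) $ i))) = (\<Prod>i\<in>UNIV. LINT s|lborel. f i s)" (is ?B)
proof -
  define k :: "real^'n \<Rightarrow> 'n" where "k b = the_inv (\<lambda>i. axis i (1::real)) b" for b
  have inj: "inj (\<lambda>i::'n. axis i (1::real))" by (auto simp: inj_on_def axis_eq_axis)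
  have k: "k (axis i 1) = i" for i unfolding k_def by (rule the_inv_f_f[OF inj])
  interpret product_sigma_finite "\<lambda>_::real^'n. lborel :: real measure" ..
  have [measurable]: "f i \<in> borel_measurable borel" for i using f[of i] by (simp add: borel_measurable_integrable)
  have T[measurable]: "(\<lambda>g. \<Sum>b\<in>Basis. g b *\<^sub>R b) \<in> (\<Pi>\<^sub>M b\<in>Basis. lborel) \<rightarrow>\<^sub>M (borel :: (real^'n) measure)"
    by measurable
  have F[measurable]: "(\<lambda>x::real^'n. \<Prod>i\<in>UNIV. f i (x $ i)) \<in> borel_measurable borel"
    by measurable
  have comp: "(\<Sum>b\<in>Basis. g b *\<^sub>R b) $ i = g (axis i 1)" for g :: "real^'n \<Rightarrow> real" and i
  proof -
    have "(\<Sum>b\<in>Basis. g b *\<^sub>R b) $ i = (\<Sum>b\<in>Basis. g b *\<^sub>R b) \<bullet> axis i 1" by (simp add: inner_axis)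
    also have "\<dots> = g (axis i 1)" by (rule inner_sum_left_Basis) (simp add: Basis_cart_eq)
    finally show ?thesis .
  qed
  have reindex: "(\<Prod>i\<in>UNIV. h i (axis i 1)) = (\<Prod>b\<in>Basis. h (k b) b)" for h :: "'n \<Rightarrow> real^'n \<Rightarrow> complex"
    unfolding Basis_cart_eq by (subst prod.reindex[OF inj]) (simp add: k)
  have eq: "(\<Prod>i\<in>UNIV. f i ((\<Sum>b\<in>Basis. g b *\<^sub>R b) $ i)) = (\<Prod>b\<in>Basis. f (k b) (g b))" for g
    unfolding comp by (rule reindex)
  have int: "integrable (\<Pi>\<^sub>M b\<in>Basis. lborel) (\<lambda>g. \<Prod>b\<in>Basis. f (k b) (g b))"
    by (rule product_integrable_prod) (auto intro: f)
  have L: "(lborel :: (real^'n) measure) = distr (\<Pi>\<^sub>M b\<in>Basis. lborel) borel (\<lambda>g. \<Sum>b\<in>Basis. g b *\<^sub>R b)"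
    by (rule lborel_eq)
  show ?A
    unfolding L integrable_distr_eq[OF T F] eq by (rule int)
  have "(LINT x|lborel. (\<Prod>i\<in>UNIV. f i ((x::real^'n) $ i))) = (LINT g|(\<Pi>\<^sub>M b\<in>Basis. lborel). (\<Prod>b\<in>Basis. f (k b) (g b)))"
    unfolding L integral_distr[OF T F] eq ..
  also have "\<dots> = (\<Prod>b\<in>Basis. LINT s|lborel. f (k b) s)"
    by (rule product_integral_prod) (auto intro: f)
  also have "\<dots> = (\<Prod>i\<in>UNIV. LINT s|lborel. f i s)"
    by (rule reindex[symmetric])
  finally show ?B .
qed

lemma approximate_identity:
  fixes F :: "'a::euclidean_space \<Rightarrow> complex" and \<phi> :: "nat \<Rightarrow> 'a \<Rightarrow> real"
  assumes F: "isCont F x0"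
    and pos: "\<And>k x. \<phi> k x \<ge> 0" and int: "\<And>k. integrable lborel (\<phi> k)" and one: "\<And>k. (LINT x|lborel. \<phi> k x) = 1"
    and supp: "\<And>k x. \<phi> k x \<noteq> 0 \<Longrightarrow> dist x x0 \<le> \<delta> k" and d: "\<delta> \<longlonglongrightarrow> 0"
    and Fint: "\<And>k. complex_integrable lborel (\<lambda>x. F x * \<phi> k x)"
  shows "(\<lambda>k. LINT x|lborel. F x * \<phi> k x) \<longlonglongrightarrow> F x0"
proof (rule tendstoI)
  fix e :: real assume e: "e > 0"
  obtain d' where d': "d' > 0" "\<And>x. dist x x0 < d' \<Longrightarrow> dist (F x) (F x0) < e / 2"
    using F e unfolding continuous_at_eps_delta by (meson half_gt_zero)
  have "\<forall>\<^sub>F k in sequentially. \<delta> k < d'" using d d'(1) by (simp add: order_tendsto_iff)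
  then show "\<forall>\<^sub>F k in sequentially. dist (LINT x|lborel. F x * \<phi> k x) (F x0) < e"
  proof eventually_elim
    case (elim k)
    have i2: "complex_integrable lborel (\<lambda>x. F x0 * \<phi> k x)"
      using int[of k] by (intro integrable_mult_right) auto
    have "(LINT x|lborel. F x * \<phi> k x) - F x0 = (LINT x|lborel. F x * \<phi> k x) - (LINT x|lborel. F x0 * \<phi> k x)"
      using one[of k] by simp
    also have "\<dots> = (LINT x|lborel. F x * \<phi> k x - F x0 * \<phi> k x)"
      by (rule Bochner_Integration.integral_diff[symmetric]) (intro Fint i2)+
    finally have "norm ((LINT x|lborel. F x * \<phi> k x) - F x0) \<le> (LINT x|lborel. norm (F x * \<phi> k x - F x0 * \<phi> k x))"
      by simp
    also have "\<dots> \<le> (LINT x|lborel. e / 2 * \<phi> k x)"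
    proof (rule integral_mono)
      fix x
      show "norm (F x * \<phi> k x - F x0 * \<phi> k x) \<le> e / 2 * \<phi> k x"
      proof (cases "\<phi> k x = 0")
        case False
        then have "dist (F x) (F x0) < e / 2" using supp[of k x] elim by (intro d'(2)) auto
        then show ?thesis using pos[of k x] 
          using mult_right_mono[of "norm (F x - F x0)" "e / 2" "\<phi> k x"]
          by (simp add: dist_norm norm_mult flip: left_diff_distrib)
      qed simp
    qed (use int Fint i2 in auto)
    also have "\<dots> = e / 2" using one[of k] by simp
    finally show ?case using e by (simp add: dist_norm)
  qed
qed

section \<open>Smooth bumps and their Fourier transforms\<close>

text \<open>A quadratic bound on the error takes the place of a limit argument, both at the edge of a bump and for differentiation under the integral sign.\<close>
lemma has_vector_derivative_quadratic:
  fixes f :: "real \<Rightarrow> 'a::real_normed_vector"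
  assumes q: "\<And>y. norm (f y - f x - (y - x) *\<^sub>R D) \<le> C * (y - x)\<^sup>2"
  shows "(f has_vector_derivative D) (at x)"
  unfolding has_vector_derivative_def
proof (rule has_derivativeI_sandwich[where e=1 and H="\<lambda>y. C * \<bar>y - x\<bar>"])
  show "bounded_linear (\<lambda>h. h *\<^sub>R D)" by (rule bounded_linear_scaleR_left)
  show "norm (f y - f x - (y - x) *\<^sub>R D) / norm (y - x) \<le> C * \<bar>y - x\<bar>" if "y \<noteq> x" for y
    using q[of y] that by (simp add: field_simps power2_eq_square abs_mult_self_eq)
  have "((\<lambda>y. C * \<bar>y - x\<bar>) \<longlongrightarrow> C * \<bar>x - x\<bar>) (at x)" by (intro tendsto_intros)
  then show "((\<lambda>y. C * \<bar>y - x\<bar>) \<longlongrightarrow> 0) (at x)" by simp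
qed auto

text \<open>The factors $p(x)(1-x^2)^{-m}$ make the family closed under differentiation and under
  multiplication by polynomials; the standard bump is the member with $p = 1$ and $m = 0$.\<close>
definition bump :: "real poly \<Rightarrow> nat \<Rightarrow> real \<Rightarrow> real" where
  "bump p m x = (if \<bar>x\<bar> < 1 then poly p x * inverse (1 - x\<^sup>2) ^ m * exp (- inverse (1 - x\<^sup>2)) else 0)"

text \<open>The numerator that arises when \<open>bump p m\<close> is differentiated and written with denominator
  $(1-x^2)^{m+2}$.\<close>
definition bump_diff :: "nat \<Rightarrow> real poly \<Rightarrow> real poly" where
  "bump_diff m p = pderiv p * [:1, 0, -1:] ^ 2 + [:0, 2 * real m:] * p * [:1, 0, -1:] - [:0, 2:] * p"

lemma power_over_fact_le_exp:
  fixes x :: real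
  assumes "x \<ge> 0"
  shows "x ^ n / fact n \<le> exp x"
proof -
  have "(\<Sum>k\<in>{n}. x ^ k /\<^sub>R fact k) \<le> exp x"
    unfolding sums_unique[OF exp_converges[of x]]
    by (intro sum_le_suminf sums_summable[OF exp_converges]) (use assms in auto)
  then show ?thesis by (simp add: divide_inverse mult.commute)
qed

text \<open>Vanishing to second order at the end points: with $u = 1-x^2$, the factor $e^{-1/u}$ beats any
  power of $1/u$, and $u$ is at most twice the distance to the end point.\<close>
lemma bump_quadratic_bound:
  "\<exists>C. \<forall>x y. \<bar>x\<bar> = 1 \<longrightarrow> \<bar>bump p m y\<bar> \<le> C * (y - x)\<^sup>2"
proof -
  have "bounded (poly p ` {-1..1})"
    by (intro compact_imp_bounded compact_continuous_image continuous_intros) auto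
  then obtain B where "\<forall>w\<in>poly p ` {-1..1}. norm w \<le> B" unfolding bounded_iff by blast
  then have B: "\<bar>poly p y\<bar> \<le> B" if "\<bar>y\<bar> \<le> 1" for y
  proof -
    have "y \<in> {-1..1}" using that by auto
    then show ?thesis using \<open>\<forall>w\<in>poly p ` {-1..1}. norm w \<le> B\<close> by auto
  qed
  have B0: "B \<ge> 0" using B[of 0] by simp
  have "\<bar>bump p m y\<bar> \<le> (B * fact (m + 2) * 4) * (y - x)\<^sup>2" if x: "\<bar>x\<bar> = 1" for x y
  proof (cases "\<bar>y\<bar> < 1")
    case True
    define u where "u = 1 - y\<^sup>2"
    have u: "u > 0" using True by (simp add: u_def abs_square_less_1)
    have uy: "u = (1 - \<bar>y\<bar>) * (1 + \<bar>y\<bar>)" by (simp add: u_def algebra_simps power2_eq_square)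
    have "u \<le> (1 - \<bar>y\<bar>) * 2" unfolding uy using True by (intro mult_left_mono) auto
    also have "\<dots> \<le> \<bar>y - x\<bar> * 2" using x abs_triangle_ineq2[of x y] by (simp add: abs_minus_commute)
    finally have u2: "u\<^sup>2 \<le> (\<bar>y - x\<bar> * 2)\<^sup>2" using u by (intro power_mono) auto
    have "inverse u ^ (m + 2) / fact (m + 2) \<le> exp (inverse u)"
      using u by (intro power_over_fact_le_exp) simp
    then have "inverse u ^ (m + 2) \<le> fact (m + 2) * exp (inverse u)"
      by (simp only: divide_le_eq fact_gt_zero if_True mult.commute)
    then have "inverse u ^ (m + 2) * exp (- inverse u) \<le> fact (m + 2) * exp (inverse u) * exp (- inverse u)"
      by (rule mult_right_mono) simp
    then have "inverse u ^ (m + 2) * exp (- inverse u) \<le> fact (m + 2)"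
      by (simp only: mult.assoc flip: exp_add) simp
    then have "inverse u ^ (m + 2) * exp (- inverse u) * u\<^sup>2 \<le> fact (m + 2) * u\<^sup>2"
      by (rule mult_right_mono) simp
    moreover have "inverse u ^ (m + 2) * u\<^sup>2 = inverse u ^ m"
      using u by (simp add: power_add field_simps power2_eq_square)
    ultimately have "inverse u ^ m * exp (- inverse u) \<le> fact (m + 2) * u\<^sup>2"
      by (simp only: mult.assoc mult.commute[of "exp _"]) (simp only: mult.assoc[symmetric])
    also have "\<dots> \<le> fact (m + 2) * (4 * (y - x)\<^sup>2)"
      using u2 by (intro mult_left_mono) (auto simp: power_mult_distrib)
    finally have e: "inverse u ^ m * exp (- inverse u) \<le> fact (m + 2) * (4 * (y - x)\<^sup>2)" .
    have "\<bar>bump p m y\<bar> = \<bar>poly p y\<bar> * (inverse u ^ m * exp (- inverse u))"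
      using True u by (simp add: bump_def abs_mult power_abs flip: u_def)
    also have "\<dots> \<le> B * (fact (m + 2) * (4 * (y - x)\<^sup>2))"
    proof (rule mult_mono[OF B e B0])
      show "\<bar>y\<bar> \<le> 1" "0 \<le> inverse u ^ m * exp (- inverse u)" using True u by simp_all
    qed
    finally show ?thesis by (simp add: mult.assoc)
  qed (use B0 in \<open>simp add: bump_def\<close>)
  then show ?thesis by blast
qed

lemma DERIV_bump: "(bump p m has_real_derivative bump (bump_diff m p) (m + 2) x) (at x)"
proof -
  consider "\<bar>x\<bar> < 1" | "\<bar>x\<bar> = 1" | "\<bar>x\<bar> > 1" by linarith
  then show ?thesis
  proof cases
    case 1
    define v where "v y = inverse (1 - y\<^sup>2)" for y :: real
    have ne: "1 - x\<^sup>2 \<noteq> 0" using 1 by (metis abs_square_less_1 less_irrefl right_minus_eq)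
    have dv: "(v has_real_derivative 2 * x * (v x)\<^sup>2) (at x)"
      unfolding v_def using ne
      by (auto intro!: derivative_eq_intros simp: power2_eq_square)
    have dvm: "((\<lambda>y. v y ^ m) has_real_derivative 2 * m * x * v x ^ (m + 1)) (at x)"
      by (rule DERIV_cong[OF DERIV_power[OF dv]]) (cases m, auto simp: power2_eq_square algebra_simps)
    have dve: "((\<lambda>y. exp (- v y)) has_real_derivative - (2 * x * (v x)\<^sup>2 * exp (- v x))) (at x)"
      by (rule derivative_eq_intros dv refl)+ simp
    have d: "((\<lambda>y. poly p y * v y ^ m * exp (- v y)) has_real_derivative
        (poly (pderiv p) x * v x ^ m + poly p x * (2 * m * x * v x ^ (m + 1))) * exp (- v x)
         + poly p x * v x ^ m * (- (2 * x * (v x)\<^sup>2 * exp (- v x)))) (at x)"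
      using DERIV_mult[OF DERIV_mult[OF poly_DERIV[of p x] dvm] dve] by (simp add: algebra_simps)
    have uv: "(1 - x\<^sup>2) * v x = 1" using ne by (simp add: v_def)
    have "poly (bump_diff m p) x * v x ^ (m + 2) =
       poly (pderiv p) x * ((1 - x\<^sup>2) * v x)\<^sup>2 * v x ^ m + 2 * m * x * poly p x * ((1 - x\<^sup>2) * v x) * v x ^ (m + 1)
       - 2 * x * poly p x * (v x)\<^sup>2 * v x ^ m"
      by (simp add: bump_diff_def power2_eq_square power_add algebra_simps)
    also have "\<dots> = poly (pderiv p) x * v x ^ m + poly p x * (2 * m * x * v x ^ (m + 1)) - 2 * x * poly p x * (v x)\<^sup>2 * v x ^ m"
      unfolding uv by simp
    finally have *: "poly (bump_diff m p) x * v x ^ (m + 2) =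
        poly (pderiv p) x * v x ^ m + poly p x * (2 * m * x * v x ^ (m + 1)) - 2 * x * poly p x * (v x)\<^sup>2 * v x ^ m" .
    have "bump (bump_diff m p) (m + 2) x = (poly (bump_diff m p) x * v x ^ (m + 2)) * exp (- v x)"
      using 1 by (simp add: bump_def v_def)
    then have "bump (bump_diff m p) (m + 2) x = 
        (poly (pderiv p) x * v x ^ m + poly p x * (2 * m * x * v x ^ (m + 1))) * exp (- v x)
         + poly p x * v x ^ m * (- (2 * x * (v x)\<^sup>2 * exp (- v x)))"
      unfolding * by (simp add: algebra_simps)
    with d have "((\<lambda>y. poly p y * v y ^ m * exp (- v y)) has_real_derivative bump (bump_diff m p) (m + 2) x) (at x)"
      by simp
    then show ?thesis
      by (rule has_field_derivative_transform_within_open[where S="{-1<..<1}"])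
         (use 1 in \<open>auto simp: bump_def v_def\<close>)
  next
    case 2
    obtain C where C: "\<And>x y. \<bar>x\<bar> = 1 \<Longrightarrow> \<bar>bump p m y\<bar> \<le> C * (y - x)\<^sup>2"
      using bump_quadratic_bound by blast
    have "(bump p m has_vector_derivative 0) (at x)"
      by (rule has_vector_derivative_quadratic[where C=C]) (use C[OF 2] 2 in \<open>auto simp: bump_def\<close>)
    then show ?thesis using 2 by (simp add: bump_def has_real_derivative_iff_has_vector_derivative)
  next
    case 3
    have "((\<lambda>_. 0) has_real_derivative bump (bump_diff m p) (m + 2) x) (at x)"
      using 3 by (simp add: bump_def)
    then show ?thesis
      by (rule has_field_derivative_transform_within_open[where S="- {-1..1}"])
         (use 3 in \<open>auto simp: bump_def\<close>)
  qed
qed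

definition pulse :: "real poly \<Rightarrow> nat \<Rightarrow> real \<Rightarrow> real \<Rightarrow> real \<Rightarrow> real" where
  "pulse p m a d x = bump p m ((x - a) / d)"

lemma DERIV_pulse:
  assumes "d > 0"
  shows "(pulse p m a d has_real_derivative pulse (bump_diff m p) (m + 2) a d x / d) (at x)"
proof -
  have "((\<lambda>x. (x - a) / d) has_real_derivative 1 / d) (at x)"
    using assms by (auto intro!: derivative_eq_intros)
  from DERIV_chain2[OF DERIV_bump this, of p m] show ?thesis
    unfolding pulse_def[abs_def] by simp
qed

lemma continuous_pulse: "d > 0 \<Longrightarrow> continuous_on A (pulse p m a d)"
  by (meson DERIV_atLeastAtMost_imp_continuous_on DERIV_pulse DERIV_isCont continuous_at_imp_continuous_on)

lemma pulse_eq_0: "d > 0 \<Longrightarrow> d \<le> \<bar>x - a\<bar> \<Longrightarrow> pulse p m a d x = 0"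
  by (simp add: pulse_def bump_def)

lemma integrable_pulse:
  assumes d: "d > 0"
  shows "integrable lborel (pulse p m a d)"
proof -
  have "set_integrable lborel {a - d..a + d} (pulse p m a d)"
    by (rule borel_integrable_atLeastAtMost') (rule continuous_pulse[OF d])
  moreover have "indicator {a - d..a + d} x *\<^sub>R pulse p m a d x = pulse p m a d x" for x
  proof (cases "x \<in> {a - d..a + d}")
    case False
    then have "d \<le> \<bar>x - a\<bar>" by auto
    then show ?thesis using pulse_eq_0[OF d] by simp
  qed simp
  ultimately show ?thesis by (simp only: set_integrable_def)
qed

lemma bounded_pulse:
  assumes d: "d > 0"
  shows "\<exists>B. \<forall>x. \<bar>pulse p m a d x\<bar> \<le> B"
proof -
  have "bounded (pulse p m a d ` {a - d..a + d})"
    by (intro compact_imp_bounded compact_continuous_image continuous_pulse[OF d]) auto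
  then obtain B where B: "\<forall>w\<in>pulse p m a d ` {a - d..a + d}. norm w \<le> B" unfolding bounded_iff by blast
  have "\<bar>pulse p m a d x\<bar> \<le> B" for x
  proof (cases "x \<in> {a - d..a + d}")
    case False
    have "B \<ge> 0" using B[rule_format, of "pulse p m a d a"] d by auto
    then show ?thesis using False d by (subst pulse_eq_0) auto
  qed (use B in auto)
  then show ?thesis by blast
qed

text \<open>Multiplication by $x$ on the space side is differentiation on the Fourier side, so this closure
  property is what keeps the derivatives of \<open>wave\<close> inside the family.\<close>
lemma pulse_mult_id:
  assumes "d > 0"
  shows "x * pulse p m a d x = pulse ([:a, d:] * p) m a d x"
proof -
  define w where "w = (x - a) / d"
  have "x = a + w * d" using assms by (simp add: w_def)
  then show ?thesis by (simp add: pulse_def bump_def distrib_right flip: w_def)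
qed

definition wave :: "real poly \<Rightarrow> nat \<Rightarrow> real \<Rightarrow> real \<Rightarrow> real \<Rightarrow> complex" where
  "wave p m a d s = (CLINT x|lborel. complex_of_real (pulse p m a d x) * iexp (x * s))"

lemma integrable_pulse_iexp:
  assumes d: "d > 0"
  shows "complex_integrable lborel (\<lambda>x. complex_of_real (pulse p m a d x) * iexp (x * s))"
  by (rule Bochner_Integration.integrable_bound[OF integrable_pulse[OF d, of p m a]])
     (use borel_measurable_integrable[OF integrable_pulse[OF d, of p m a]] in \<open>auto simp: norm_mult\<close>)

text \<open>Differentiation under the integral sign, from the second-order Taylor estimate for $e^{i\theta}$
  and the integrability of $x^2$ times the pulse.\<close>
lemma wave_has_vector_derivative:
  assumes d: "d > 0"
  shows "(wave p m a d has_vector_derivative \<i> * wave ([:a, d:] * p) m a d s) (at s)"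
proof (rule has_vector_derivative_quadratic)
  fix r
  let ?p = "pulse p m a d"
  have i2: "integrable lborel (\<lambda>x. x\<^sup>2 * \<bar>?p x\<bar>)"
  proof -
    have "integrable lborel (\<lambda>x. \<bar>pulse ([:a, d:] * ([:a, d:] * p)) m a d x\<bar>)"
      by (intro integrable_abs integrable_pulse d)
    also have "(\<lambda>x. \<bar>pulse ([:a, d:] * ([:a, d:] * p)) m a d x\<bar>) = (\<lambda>x. x\<^sup>2 * \<bar>?p x\<bar>)"
      unfolding pulse_mult_id[OF d, symmetric] by (simp add: fun_eq_iff abs_mult power2_eq_square abs_mult_self_eq flip: mult.assoc)
    finally show ?thesis .
  qed
  have *: "wave p m a d r - wave p m a d s - (r - s) *\<^sub>R (\<i> * wave ([:a, d:] * p) m a d s) =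
    (CLINT x|lborel. ?p x * iexp (x * r) - ?p x * iexp (x * s) - ((r - s) * \<i>) * (pulse ([:a, d:] * p) m a d x * iexp (x * s)))"
    unfolding wave_def using d
    by (simp add: integrable_pulse_iexp scaleR_conv_of_real mult.assoc del: of_real_mult of_real_diff)
  have "norm (wave p m a d r - wave p m a d s - (r - s) *\<^sub>R (\<i> * wave ([:a, d:] * p) m a d s))
     \<le> (LINT x|lborel. norm (?p x * iexp (x * r) - ?p x * iexp (x * s) - ((r - s) * \<i>) * (pulse ([:a, d:] * p) m a d x * iexp (x * s))))"
    unfolding * by (rule integral_norm_bound)
  also have "\<dots> \<le> (LINT x|lborel. (r - s)\<^sup>2 / 2 * (x\<^sup>2 * \<bar>?p x\<bar>))"
  proof (rule integral_mono)
    show "integrable lborel (\<lambda>x. norm (?p x * iexp (x * r) - ?p x * iexp (x * s) - ((r - s) * \<i>) * (pulse ([:a, d:] * p) m a d x * iexp (x * s))))"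
      by (intro integrable_norm Bochner_Integration.integrable_diff integrable_mult_right integrable_pulse_iexp d)
    fix x
    have "?p x * iexp (x * r) - ?p x * iexp (x * s) - ((r - s) * \<i>) * (pulse ([:a, d:] * p) m a d x * iexp (x * s)) =
       ?p x * iexp (x * s) * (iexp (x * (r - s)) - (\<Sum>k\<le>1. (\<i> * (x * (r - s)))^k / fact k))"
      unfolding pulse_mult_id[OF d, symmetric]
      by (simp add: algebra_simps flip: exp_add)
    also have "norm \<dots> \<le> \<bar>?p x\<bar> * (\<bar>x * (r - s)\<bar> ^ Suc 1 / fact (Suc 1))"
    proof -
      have "norm (?p x * iexp (x * s)) = \<bar>?p x\<bar>" by (simp add: norm_mult)
      then show ?thesis
        unfolding norm_mult[of "?p x * iexp (x * s)"]
        using mult_left_mono[OF iexp_approx1[of "x * (r - s)" 1], of "\<bar>?p x\<bar>"] by simp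
    qed
    also have "\<bar>x * (r - s)\<bar> ^ Suc 1 / fact (Suc 1) = (r - s)\<^sup>2 / 2 * x\<^sup>2"
      using power2_abs[of "x * (r - s)"] by (simp add: power_mult_distrib power2_eq_square[symmetric] del: power2_abs)
    also have "\<bar>?p x\<bar> * ((r - s)\<^sup>2 / 2 * x\<^sup>2) = (r - s)\<^sup>2 / 2 * (x\<^sup>2 * \<bar>?p x\<bar>)" by simp
    finally show "norm (?p x * iexp (x * r) - ?p x * iexp (x * s) - ((r - s) * \<i>) * (pulse ([:a, d:] * p) m a d x * iexp (x * s))) \<le> (r - s)\<^sup>2 / 2 * (x\<^sup>2 * \<bar>?p x\<bar>)" .
  qed (use i2 in auto)
  finally show "norm (wave p m a d r - wave p m a d s - (r - s) *\<^sub>R (\<i> * wave ([:a, d:] * p) m a d s)) \<le>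
     ((LINT x|lborel. x\<^sup>2 * \<bar>?p x\<bar>) / 2) * (r - s)\<^sup>2"
    by (simp only: integral_mult_right_zero) (simp only: mult.commute times_divide_eq_left times_divide_eq_right)
qed

lemma wave_by_parts:
  assumes d: "d > 0"
  shows "\<i> * s * wave p m a d s = - wave (bump_diff m p) (m + 2) a d s / d"
proof -
  let ?p = "pulse p m a d" and ?q = "pulse (bump_diff m p) (m + 2) a d"
  define F where "F x = complex_of_real (?p x) * iexp (x * s)" for x
  define f where "f x = (1 / d) * (complex_of_real (?q x) * iexp (x * s)) + \<i> * s * (complex_of_real (?p x) * iexp (x * s))" for x
  have "integral\<^sup>L lborel f = 0"
  proof (rule integral_derivative_eq_0)
    fix x
    have "((\<lambda>x. complex_of_real (?p x)) has_vector_derivative complex_of_real (?q x / d)) (at x)"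
      by (intro has_vector_derivative_of_real) (use DERIV_pulse[OF d] in \<open>simp add: has_real_derivative_iff_has_vector_derivative\<close>)
    moreover have "((\<lambda>x. iexp (x * s)) has_vector_derivative \<i> * s * iexp (x * s)) (at x)"
      by (rule has_vector_derivative_iexp_mult)
    ultimately show "(F has_vector_derivative f x) (at x)" unfolding F_def f_def
      by (rule has_vector_derivative_eq_rhs[OF has_vector_derivative_mult]) (simp add: algebra_simps)
    have "continuous_on UNIV f"
      unfolding f_def by (intro continuous_intros continuous_pulse d)
    then show "isCont f x" by (simp add: continuous_on_eq_continuous_at)
  next
    show "integrable lborel f" unfolding f_def
      by (intro Bochner_Integration.integrable_add integrable_mult_right integrable_pulse_iexp d)
    have F0: "F x = 0" if "\<bar>x - a\<bar> \<ge> d" for x using pulse_eq_0[OF d that] by (simp add: F_def)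
    have "\<forall>\<^sub>F x in at_bot. F x = 0"
      using eventually_le_at_bot[of "a - d"] by eventually_elim (rule F0, auto)
    then show "(F \<longlongrightarrow> 0) at_bot" by (simp add: tendsto_eventually)
    have "\<forall>\<^sub>F x in at_top. F x = 0"
      using eventually_ge_at_top[of "a + d"] by eventually_elim (rule F0, auto)
    then show "(F \<longlongrightarrow> 0) at_top" by (simp add: tendsto_eventually)
  qed
  moreover have "integral\<^sup>L lborel f = (1 / d) * wave (bump_diff m p) (m + 2) a d s + \<i> * s * wave p m a d s"
    unfolding f_def wave_def
    by (subst Bochner_Integration.integral_add)
       (intro integrable_mult_right integrable_pulse_iexp d | simp only: integral_mult_right_zero)+
  ultimately show ?thesis by (simp add: add_eq_0_iff)
qed

lemma wave_decay:
  assumes d: "d > 0"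
  shows "\<exists>C. \<forall>s. \<bar>s\<bar> ^ k * norm (wave p m a d s) \<le> C"
proof (induction k arbitrary: p m)
  case 0
  have "norm (wave p m a d s) \<le> (LINT x|lborel. \<bar>pulse p m a d x\<bar>)" for s
    unfolding wave_def by (rule order_trans[OF integral_norm_bound]) (simp add: norm_mult)
  then show ?case by auto
next
  case (Suc k)
  obtain C where C: "\<And>s. \<bar>s\<bar> ^ k * norm (wave (bump_diff m p) (m + 2) a d s) \<le> C" using Suc by blast
  have "\<bar>s\<bar> ^ Suc k * norm (wave p m a d s) \<le> C / d" for s
  proof -
    have "\<bar>s\<bar> ^ Suc k * norm (wave p m a d s) = \<bar>s\<bar> ^ k * norm (\<i> * s * wave p m a d s)"
      by (simp add: norm_mult)
    also have "\<dots> = (\<bar>s\<bar> ^ k * norm (wave (bump_diff m p) (m + 2) a d s)) / d"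
      unfolding wave_by_parts[OF d] using d by (simp add: norm_divide)
    also have "\<dots> \<le> C / d" using C d by (intro divide_right_mono) auto
    finally show ?thesis .
  qed
  then show ?case by blast
qed

text \<open>Each integration by parts (\<open>wave_by_parts\<close>) gains a power of $s$ and stays in the family.\<close>
lemma wave_rapid_decay:
  assumes d: "d > 0"
  shows "\<exists>C. \<forall>s. (1 + \<bar>s\<bar>) ^ k * norm (wave p m a d s) \<le> C"
proof -
  obtain C0 where C0: "\<And>s. \<bar>s\<bar> ^ 0 * norm (wave p m a d s) \<le> C0" using wave_decay[OF d] by blast
  obtain C where C: "\<And>s. \<bar>s\<bar> ^ k * norm (wave p m a d s) \<le> C" using wave_decay[OF d] by blast
  have "(1 + \<bar>s\<bar>) ^ k * norm (wave p m a d s) \<le> 2 ^ k * (C0 + C)" for s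
  proof -
    have "(1 + \<bar>s\<bar>) ^ k \<le> (2 * max 1 \<bar>s\<bar>) ^ k" by (intro power_mono) auto
    also have "\<dots> \<le> 2 ^ k * (1 + \<bar>s\<bar> ^ k)"
      by (auto simp: power_mult_distrib max_def)
    finally have "(1 + \<bar>s\<bar>) ^ k * norm (wave p m a d s) \<le> 2 ^ k * (1 + \<bar>s\<bar> ^ k) * norm (wave p m a d s)"
      by (intro mult_right_mono) auto
    also have "\<dots> = 2 ^ k * (\<bar>s\<bar> ^ 0 * norm (wave p m a d s) + \<bar>s\<bar> ^ k * norm (wave p m a d s))"
      by (simp add: algebra_simps)
    also have "\<dots> \<le> 2 ^ k * (C0 + C)" by (intro mult_left_mono add_mono C0 C) auto
    finally show ?thesis .
  qed
  then show ?thesis by blast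
qed

lemma integrable_wave:
  assumes d: "d > 0"
  shows "integrable lborel (wave p m a d)"
proof -
  obtain C where C: "\<And>s. (1 + \<bar>s\<bar>) ^ 2 * norm (wave p m a d s) \<le> C" using wave_rapid_decay[OF d] by blast
  have "integrable lborel (\<lambda>s::real. inverse (1 + s\<^sup>2))"
    using integrable_inverse_1_plus_square by (simp add: set_integrable_def)
  then have "integrable lborel (\<lambda>s::real. C * inverse (1 + s\<^sup>2))" by (rule integrable_mult_right)
  moreover have "continuous_on UNIV (wave p m a d)"
    using wave_has_vector_derivative[OF d]
    by (meson continuous_at_imp_continuous_on has_vector_derivative_continuous)
  then have "wave p m a d \<in> borel_measurable borel" by (rule borel_measurable_continuous_onI)
  moreover have "norm (wave p m a d s) \<le> norm (C * inverse (1 + s\<^sup>2))" for s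
  proof -
    have "(1 + s\<^sup>2) * norm (wave p m a d s) \<le> (1 + \<bar>s\<bar>) ^ 2 * norm (wave p m a d s)"
      by (intro mult_right_mono) (auto simp: power2_sum)
    also have "\<dots> \<le> C" by (rule C)
    finally have "norm (wave p m a d s) \<le> C * inverse (1 + s\<^sup>2)"
      by (simp add: field_simps add_pos_nonneg)
    then show ?thesis using abs_ge_self order_trans unfolding real_norm_def by blast
  qed
  ultimately show ?thesis
    by (intro Bochner_Integration.integrable_bound[where f="\<lambda>s. C * inverse (1 + s\<^sup>2)" and g="wave p m a d"])
       simp_all
qed

lemma Fourier_multiplication_formula:
  fixes f g :: "real \<Rightarrow> complex"
  assumes f: "integrable lborel f" and g: "integrable lborel g"
  shows "(CLINT s|lborel. f s * (CLINT y|lborel. g y * iexp (y * s))) = (CLINT y|lborel. g y * (CLINT s|lborel. f s * iexp (s * y)))"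
proof -
  have [measurable]: "f \<in> borel_measurable borel" "g \<in> borel_measurable borel"
    using f g by (auto simp: borel_measurable_integrable)
  define h where "h s y = f s * g y * iexp (s * y)" for s y
  have n: "norm (h s y) = norm (f s) * norm (g y)" for s y by (simp add: h_def norm_mult)
  have gi: "complex_integrable lborel (\<lambda>y. g y * iexp (y * s))" for s
    by (rule Bochner_Integration.integrable_bound[OF g]) (auto simp: norm_mult)
  have "integrable (lborel \<Otimes>\<^sub>M lborel) (case_prod h)"
  proof (rule lborel_pair.Fubini_integrable)
    show "case_prod h \<in> borel_measurable (lborel \<Otimes>\<^sub>M lborel)" unfolding h_def by measurable
    show "integrable lborel (\<lambda>x. LINT y|lborel. norm (case_prod h (x, y)))"
      using f g by (simp add: n)
    show "AE x in lborel. complex_integrable lborel (\<lambda>y. case_prod h (x, y))"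
    proof (intro AE_I2)
      fix s
      have "complex_integrable lborel (\<lambda>y. f s * (g y * iexp (y * s)))"
        by (intro integrable_mult_right gi)
      then show "complex_integrable lborel (\<lambda>y. case_prod h (s, y))" by (simp add: h_def mult_ac)
    qed
  qed
  from lborel_pair.Fubini_integral[OF this]
  have "(CLINT y|lborel. CLINT s|lborel. h s y) = (CLINT s|lborel. CLINT y|lborel. h s y)" .
  moreover have "(CLINT y|lborel. h s y) = f s * (CLINT y|lborel. g y * iexp (y * s))" for s
  proof -
    have "(CLINT y|lborel. h s y) = (CLINT y|lborel. f s * (g y * iexp (y * s)))"
      by (simp add: h_def mult_ac)
    then show ?thesis by (simp only: integral_mult_right_zero)
  qed
  moreover have "(CLINT s|lborel. h s y) = g y * (CLINT s|lborel. f s * iexp (s * y))" for y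
  proof -
    have "(CLINT s|lborel. h s y) = (CLINT s|lborel. g y * (f s * iexp (s * y)))"
      by (simp add: h_def mult_ac)
    then show ?thesis by (simp only: integral_mult_right_zero)
  qed
  ultimately show ?thesis by simp
qed

text \<open>Insert the convergence factor $e^{-\varepsilon s^2}$. By the multiplication formula the
  regularised integral is the convolution of the bump with a narrow Gaussian, which tends to a
  multiple of the bump as $\varepsilon \to 0$ by dominated convergence.\<close>
lemma wave_inversion:
  assumes d: "d > 0"
  shows "(CLINT s|lborel. wave p m a d s * iexp (- (s * x))) = 2 * pi * pulse p m a d x"
proof (rule LIMSEQ_unique)
  let ?f = "pulse p m a d"
  define c where "c k = inverse (real (Suc k))" for k
  have c: "c k > 0" for k by (simp add: c_def)
  have c0: "c \<longlonglongrightarrow> 0" unfolding c_def by (rule LIMSEQ_inverse_real_of_nat)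
  \<comment> \<open>chosen so that the Gaussian $e^{-(y-x)^2/4e_k}$ becomes $e^{-w^2}$ under $y = x + c_k w$\<close>
  define e where "e k = (c k)\<^sup>2 / 4" for k
  have e: "e k > 0" for k using c[of k] by (simp add: e_def)
  have [measurable]: "?f \<in> borel_measurable borel" "wave p m a d \<in> borel_measurable borel"
    using integrable_pulse[OF d] integrable_wave[OF d] by (auto simp: borel_measurable_integrable)
  let ?L = "\<lambda>k. CLINT s|lborel. (complex_of_real (damped_power 0 (e k) 0 s) * iexp (s * - x)) * wave p m a d s"
  have "?L \<longlonglongrightarrow> (CLINT s|lborel. (complex_of_real 1 * iexp (s * -x)) * wave p m a d s)"
  proof (rule integral_dominated_convergence[where w="\<lambda>s. norm (wave p m a d s)"])
    show "integrable lborel (\<lambda>s. norm (wave p m a d s))" using integrable_wave[OF d] by simp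
    have e0: "e \<longlonglongrightarrow> 0" unfolding e_def using tendsto_divide[OF tendsto_power[OF c0, of 2], of "\<lambda>_. 4" 4] by simp
    have "(\<lambda>k. damped_power 0 (e k) 0 s) \<longlonglongrightarrow> 1" for s
      unfolding damped_power_def by (rule tendsto_eq_intros e0 refl | simp)+
    then show "AE s in lborel. (\<lambda>k. (complex_of_real (damped_power 0 (e k) 0 s) * iexp (s * - x)) * wave p m a d s)
       \<longlonglongrightarrow> (complex_of_real 1 * iexp (s * -x)) * wave p m a d s"
      by (intro AE_I2 tendsto_intros) auto
    show "AE s in lborel. norm ((complex_of_real (damped_power 0 (e k) 0 s) * iexp (s * - x)) * wave p m a d s) \<le> norm (wave p m a d s)" for k
      using e[of k] by (intro AE_I2) (auto simp: norm_mult damped_power_def intro!: mult_left_le_one_le)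
  qed (measurable)
  then show "?L \<longlonglongrightarrow> (CLINT s|lborel. wave p m a d s * iexp (- (s * x)))" by (simp add: mult.commute)
  have L: "?L k = complex_of_real (2 * sqrt pi * (LINT w|lborel. ?f (x + c k * w) * exp (- w\<^sup>2)))" for k
  proof -
    have "?L k = (CLINT y|lborel. ?f y * (CLINT s|lborel. (complex_of_real (damped_power 0 (e k) 0 s) * iexp (s * - x)) * iexp (s * y)))"
      unfolding wave_def
      by (rule Fourier_multiplication_formula)
         (use integrable_damped_power_iexp[of "e k" 0 0 "- x"] e[of k] integrable_pulse[OF d] in auto)
    also have "\<dots> = (CLINT y|lborel. ?f y * osc_integral 0 (e k) 0 (y - x))"
      unfolding osc_integral_def by (simp add: algebra_simps exp_diff exp_minus field_simps)
    also have "\<dots> = (CLINT y|lborel. complex_of_real (?f y * (sqrt (pi / e k) * exp (- ((y - x)\<^sup>2 / (4 * e k))))))"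
      using osc_integral_0_gauss[OF e] by simp
    also have "\<dots> = complex_of_real (LINT y|lborel. ?f y * (sqrt (pi / e k) * exp (- ((y - x)\<^sup>2 / (4 * e k)))))"
      by (rule integral_complex_of_real)
    also have "(LINT y|lborel. ?f y * (sqrt (pi / e k) * exp (- ((y - x)\<^sup>2 / (4 * e k))))) =
      c k *\<^sub>R (LINT w|lborel. ?f (x + c k * w) * (sqrt (pi / e k) * exp (- (((x + c k * w) - x)\<^sup>2 / (4 * e k)))))"
      using c[of k] by (subst lborel_integral_real_affine[of "c k" _ x]) auto
    also have "(\<lambda>w. ?f (x + c k * w) * (sqrt (pi / e k) * exp (- (((x + c k * w) - x)\<^sup>2 / (4 * e k))))) = 
      (\<lambda>w. (sqrt (pi / e k)) * (?f (x + c k * w) * exp (- w\<^sup>2)))"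
      using c[of k] by (simp add: e_def power_mult_distrib field_simps)
    also have "c k *\<^sub>R (LINT w|lborel. (sqrt (pi / e k)) * (?f (x + c k * w) * exp (- w\<^sup>2))) = 
      (c k * sqrt (pi / e k)) * (LINT w|lborel. ?f (x + c k * w) * exp (- w\<^sup>2))"
      by simp
    also have "c k * sqrt (pi / e k) = 2 * sqrt pi"
      using c[of k] by (simp add: e_def real_sqrt_divide real_sqrt_mult)
    finally show ?thesis .
  qed
  obtain B where B: "\<And>x. \<bar>?f x\<bar> \<le> B" using bounded_pulse[OF d] by blast
  have i1: "integrable lborel (\<lambda>w::real. exp (- w\<^sup>2))"
    using integrable_damped_power_gauss[of 1 0] by (simp add: damped_power_def[abs_def])
  have "complex_of_real (LINT w|lborel. exp (- w\<^sup>2)) = osc_integral 0 1 0 0"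
    by (simp add: osc_integral_def damped_power_def)
  also have "\<dots> = complex_of_real (sqrt pi)" by (simp add: osc_integral_0_gauss)
  finally have gi: "(LINT w|lborel. exp (- w\<^sup>2)) = sqrt pi" unfolding of_real_eq_iff .
  have "(\<lambda>k. LINT w|lborel. ?f (x + c k * w) * exp (- w\<^sup>2)) \<longlonglongrightarrow> (LINT w|lborel. ?f x * exp (- w\<^sup>2))"
  proof (rule integral_dominated_convergence[where w="\<lambda>w. B * exp (- w\<^sup>2)"])
    have "isCont ?f x" using DERIV_pulse[OF d] by (rule DERIV_isCont)
    then have "(\<lambda>k. ?f (x + c k * w)) \<longlonglongrightarrow> ?f x" for w
      by (rule isCont_tendsto_compose) (rule tendsto_eq_intros c0 refl | simp)+
    then show "AE w in lborel. (\<lambda>k. ?f (x + c k * w) * exp (- w\<^sup>2)) \<longlonglongrightarrow> ?f x * exp (- w\<^sup>2)"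
      by (intro AE_I2 tendsto_intros)
    show "AE w in lborel. norm (?f (x + c k * w) * exp (- w\<^sup>2)) \<le> B * exp (- w\<^sup>2)" for k
      using B by (auto simp: abs_mult)
  qed (use i1 in auto)
  then have "(\<lambda>k. complex_of_real (2 * sqrt pi * (LINT w|lborel. ?f (x + c k * w) * exp (- w\<^sup>2))))
     \<longlonglongrightarrow> complex_of_real (2 * sqrt pi * (LINT w|lborel. ?f x * exp (- w\<^sup>2)))"
    by (intro tendsto_intros)
  moreover have "2 * sqrt pi * (LINT w|lborel. ?f x * exp (- w\<^sup>2)) = 2 * pi * ?f x"
    by (simp add: gi)
  ultimately show "?L \<longlonglongrightarrow> 2 * pi * ?f x"
    unfolding L by (simp only: of_real_mult of_real_numeral)
qed

lemma pulse_1_nonneg: "pulse 1 0 a d x \<ge> 0"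
  by (simp add: pulse_def bump_def)

lemma integral_pulse_pos:
  assumes d: "d > 0"
  shows "(LINT x|lborel. pulse 1 0 a d x) > 0"
proof -
  let ?f = "pulse 1 0 a d" and ?I = "{a - d / 2..a + d / 2}"
  have "0 < exp (- 4 / 3) * d" using d by simp
  also have "\<dots> = (LINT x|lborel. exp (- 4 / 3) * indicator ?I x)" using d by simp
  also have "\<dots> \<le> (LINT x|lborel. ?f x)"
  proof (rule integral_mono)
    fix x
    show "exp (- 4 / 3) * indicator ?I x \<le> ?f x"
    proof (cases "x \<in> ?I")
      case True
      define w where "w = (x - a) / d"
      have w: "\<bar>w\<bar> \<le> 1 / 2" 
      proof -
        have "\<bar>x - a\<bar> \<le> d / 2" unfolding abs_le_iff using True by auto
        then show ?thesis using d by (simp add: w_def field_simps)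
      qed
      then have "w\<^sup>2 \<le> (1 / 2)\<^sup>2" by (intro power2_le_iff_abs_le[THEN iffD2]) auto
      then have "3 / 4 \<le> 1 - w\<^sup>2" by (simp add: power2_eq_square)
      then have "inverse (1 - w\<^sup>2) \<le> inverse (3 / 4)" by (rule le_imp_inverse_le) simp
      then show ?thesis using True w by (simp add: pulse_def bump_def distrib_right flip: w_def)
    qed (simp add: pulse_1_nonneg)
  qed (use d integrable_pulse in auto)
  finally show ?thesis .
qed

section \<open>Tensor products as test functions and Schwartz functions\<close>

text \<open>Closure of a set of functions of one variable under differentiation encodes smoothness without
  naming higher derivatives: iterated partial derivatives of a tensor product of members are again
  such tensor products.\<close>
definition derivative_closed :: "(real \<Rightarrow> complex) set \<Rightarrow> bool" where
  "derivative_closed S \<longleftrightarrow> (\<forall>f\<in>S. \<exists>f'\<in>S. \<forall>x. (f has_vector_derivative f' x) (at x))"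

lemma has_derivative_prod_cart:
  fixes f :: "'n::finite \<Rightarrow> real \<Rightarrow> complex" and x :: "real^'n"
  assumes "\<And>i. (f i has_vector_derivative f' i) (at (x $ i))"
  shows "((\<lambda>x. \<Prod>i\<in>UNIV. f i (x $ i)) has_derivative
     (\<lambda>h. \<Sum>i\<in>UNIV. (h $ i *\<^sub>R f' i) * (\<Prod>j\<in>UNIV - {i}. f j (x $ j)))) (at x)"
proof (rule has_derivative_prod)
  fix i
  have "((\<lambda>x. x $ i) has_derivative (\<lambda>h. h $ i)) (at x)"
    by (rule bounded_linear_imp_has_derivative[OF bounded_linear_vec_nth])
  from has_derivative_compose[OF this assms[of i, unfolded has_vector_derivative_def]]
  show "((\<lambda>x. f i (x $ i)) has_derivative (\<lambda>h. h $ i *\<^sub>R f' i)) (at x)" .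
qed

lemma partial_deriv_prod:
  fixes f :: "'n::finite \<Rightarrow> real \<Rightarrow> complex"
  assumes "\<And>i x. (f i has_vector_derivative f' i x) (at x)"
  shows "partial_deriv j (\<lambda>x. \<Prod>i\<in>UNIV. f i (x $ i)) = (\<lambda>x. \<Prod>i\<in>UNIV. (f(j := f' j)) i (x $ i))"
proof
  fix x :: "real^'n"
  have "partial_deriv j (\<lambda>x. \<Prod>i\<in>UNIV. f i (x $ i)) x =
     (\<Sum>i\<in>UNIV. (axis j 1 $ i *\<^sub>R f' i (x $ i)) * (\<Prod>k\<in>UNIV - {i}. f k (x $ k)))"
    unfolding partial_deriv_def
    by (subst frechet_derivative_at[OF has_derivative_prod_cart[of f "\<lambda>i. f' i (x $ i)" x], symmetric]) (simp_all add: assms)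
  also have "\<dots> = (\<Sum>i\<in>UNIV. if i = j then f' j (x $ j) * (\<Prod>k\<in>UNIV - {j}. f k (x $ k)) else 0)"
    by (intro sum.cong) (auto simp: axis_def)
  also have "\<dots> = f' j (x $ j) * (\<Prod>k\<in>UNIV - {j}. f k (x $ k))" by simp
  also have "(\<Prod>k\<in>UNIV - {j}. f k (x $ k)) = (\<Prod>k\<in>UNIV - {j}. (f(j := f' j)) k (x $ k))"
    by (intro prod.cong) auto
  also have "f' j (x $ j) * \<dots> = (\<Prod>k\<in>UNIV. (f(j := f' j)) k (x $ k))"
    by (subst prod.remove[of UNIV j]) auto
  finally show "partial_deriv j (\<lambda>x. \<Prod>i\<in>UNIV. f i (x $ i)) x = (\<Prod>i\<in>UNIV. (f(j := f' j)) i (x $ i))" .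
qed

lemma iter_partial_prod:
  fixes f :: "'n::finite \<Rightarrow> real \<Rightarrow> complex"
  assumes S: "derivative_closed S" and f: "\<And>i. f i \<in> S"
  shows "\<exists>g. (\<forall>i. g i \<in> S) \<and> iter_partial js (\<lambda>x. \<Prod>i\<in>UNIV. f i (x $ i)) = (\<lambda>x. \<Prod>i\<in>UNIV. g i (x $ i))"
proof (induction js)
  case Nil
  show ?case using f by (auto simp: iter_partial_def)
next
  case (Cons j js)
  then obtain g where g: "\<And>i. g i \<in> S"
      "iter_partial js (\<lambda>x. \<Prod>i\<in>UNIV. f i (x $ i)) = (\<lambda>x. \<Prod>i\<in>UNIV. g i (x $ i))" by blast
  have "\<forall>i. \<exists>g'. g' \<in> S \<and> (\<forall>x. (g i has_vector_derivative g' x) (at x))"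
    using S g(1) unfolding derivative_closed_def by blast
  then obtain g' where g': "\<And>i. g' i \<in> S" "\<And>i x. (g i has_vector_derivative g' i x) (at x)" by metis
  have "iter_partial (j # js) (\<lambda>x. \<Prod>i\<in>UNIV. f i (x $ i)) = partial_deriv j (iter_partial js (\<lambda>x. \<Prod>i\<in>UNIV. f i (x $ i)))"
    by (simp add: iter_partial_def)
  also have "\<dots> = (\<lambda>x. \<Prod>i\<in>UNIV. (g(j := g' j)) i (x $ i))"
    unfolding g(2) by (rule partial_deriv_prod[OF g'(2)])
  finally show ?case using g(1) g'(1) by (intro exI[of _ "g(j := g' j)"]) auto
qed

lemma smooth_prod:
  fixes f :: "'n::finite \<Rightarrow> real \<Rightarrow> complex"
  assumes S: "derivative_closed S" and f: "\<And>i. f i \<in> S"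
  shows "smooth (\<lambda>x::real^'n. \<Prod>i\<in>UNIV. f i (x $ i))"
  unfolding smooth_def
proof (intro allI)
  fix js and x :: "real^'n"
  obtain g where g: "\<And>i. g i \<in> S"
      "iter_partial js (\<lambda>x. \<Prod>i\<in>UNIV. f i (x $ i)) = (\<lambda>x. \<Prod>i\<in>UNIV. g i (x $ i))"
    using iter_partial_prod[where f = f and js = js, OF S f] by blast
  have "\<forall>i. \<exists>g'. (g i has_vector_derivative g') (at (x $ i))"
    using S g(1) unfolding derivative_closed_def by blast
  then obtain g' where "\<And>i. (g i has_vector_derivative g' i) (at (x $ i))" by metis
  from has_derivative_prod_cart[OF this]
  show "iter_partial js (\<lambda>x. \<Prod>i\<in>UNIV. f i (x $ i)) differentiable (at x)"
    unfolding g(2) differentiable_def by blast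
qed

lemma one_plus_sum_le_prod:
  fixes a :: "'i \<Rightarrow> real"
  assumes "finite I" "\<And>i. a i \<ge> 0"
  shows "1 + sum a I \<le> (\<Prod>i\<in>I. 1 + a i)"
  using assms(1)
proof induction
  case (insert i I)
  have "1 + sum a (insert i I) \<le> (1 + a i) * (1 + sum a I)"
    using insert assms(2) by (simp add: algebra_simps sum_nonneg)
  also have "\<dots> \<le> (1 + a i) * (\<Prod>i\<in>I. 1 + a i)"
    using insert assms(2) by (intro mult_left_mono) (auto simp: add_nonneg_nonneg)
  finally show ?case using insert by simp
qed simp

lemma one_plus_norm_le_prod:
  fixes x :: "real^'n::finite"
  shows "1 + norm x \<le> (\<Prod>i\<in>UNIV. 1 + \<bar>x $ i\<bar>)"
  using norm_le_l1_cart[of x] one_plus_sum_le_prod[of UNIV "\<lambda>i. \<bar>x $ i\<bar>"] by simp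

text \<open>The weight $(1+|x|)^k$ is dominated by the product of the weights $(1+|x_i|)^k$, so the decay of a
  tensor product can be checked factor by factor.\<close>
lemma schwartz_prod:
  fixes f :: "'n::finite \<Rightarrow> real \<Rightarrow> complex"
  assumes S: "derivative_closed S" and f: "\<And>i. f i \<in> S"
    and decay: "\<And>h k. h \<in> S \<Longrightarrow> \<exists>C. \<forall>s. (1 + \<bar>s\<bar>) ^ k * norm (h s) \<le> C"
  shows "(\<lambda>x::real^'n. \<Prod>i\<in>UNIV. f i (x $ i)) \<in> schwartz_space"
  unfolding schwartz_space_def mem_Collect_eq
proof (intro conjI allI)
  show "smooth (\<lambda>x::real^'n. \<Prod>i\<in>UNIV. f i (x $ i))" by (rule smooth_prod[OF S f])
  fix k js
  obtain g where g: "\<And>i. g i \<in> S"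
      "iter_partial js (\<lambda>x. \<Prod>i\<in>UNIV. f i (x $ i)) = (\<lambda>x. \<Prod>i\<in>UNIV. g i (x $ i))"
    using iter_partial_prod[where f = f and js = js, OF S f] by blast
  obtain C where C: "\<And>i s. (1 + \<bar>s\<bar>) ^ k * norm (g i s) \<le> C i" using decay[OF g(1), of k] by metis
  show "bdd_above (range (\<lambda>x::real^'n. (1 + norm x) ^ k * norm (iter_partial js (\<lambda>x. \<Prod>i\<in>UNIV. f i (x $ i)) x)))"
  proof (rule bdd_aboveI2)
    fix x :: "real^'n"
    have "(1 + norm x) ^ k \<le> (\<Prod>i\<in>UNIV. 1 + \<bar>x $ i\<bar>) ^ k"
      by (intro power_mono one_plus_norm_le_prod) auto
    then have "(1 + norm x) ^ k * norm (\<Prod>i\<in>UNIV. g i (x $ i)) \<le> (\<Prod>i\<in>UNIV. 1 + \<bar>x $ i\<bar>) ^ k * norm (\<Prod>i\<in>UNIV. g i (x $ i))"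
      by (rule mult_right_mono) simp
    also have "\<dots> = (\<Prod>i\<in>UNIV. (1 + \<bar>x $ i\<bar>) ^ k * norm (g i (x $ i)))"
      by (simp add: prod.distrib prod_power_distrib prod_norm)
    also have "\<dots> \<le> (\<Prod>i\<in>UNIV. C i)"
      by (intro prod_mono) (auto intro!: C)
    finally show "(1 + norm x) ^ k * norm (iter_partial js (\<lambda>x. \<Prod>i\<in>UNIV. f i (x $ i)) x) \<le> (\<Prod>i\<in>UNIV. C i)"
      unfolding g(2) .
  qed
qed

lemma derivative_closed_pulses:
  "derivative_closed {\<lambda>x. c * complex_of_real (pulse p m a d x) | c p m a d. d > 0}"
  unfolding derivative_closed_def
proof clarify
  fix c p m a and d :: real assume d: "d > 0"
  have "((\<lambda>x. c * complex_of_real (pulse p m a d x)) has_vector_derivative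
       (c / d) * complex_of_real (pulse (bump_diff m p) (m + 2) a d x)) (at x)" for x
  proof -
    have "((\<lambda>x. complex_of_real (pulse p m a d x)) has_vector_derivative complex_of_real (pulse (bump_diff m p) (m + 2) a d x / d)) (at x)"
      by (intro has_vector_derivative_of_real) (use DERIV_pulse[OF d] in \<open>simp add: has_real_derivative_iff_has_vector_derivative\<close>)
    then have "((\<lambda>x. c * complex_of_real (pulse p m a d x)) has_vector_derivative c * complex_of_real (pulse (bump_diff m p) (m + 2) a d x / d)) (at x)"
      by (rule has_vector_derivative_mult_right)
    then show ?thesis by simp
  qed
  then show "\<exists>f'\<in>{\<lambda>x. c * complex_of_real (pulse p m a d x) | c p m a d. d > 0}.
     \<forall>x. ((\<lambda>x. c * complex_of_real (pulse p m a d x)) has_vector_derivative f' x) (at x)"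
    using d by (intro bexI[of _ "\<lambda>x. (c / d) * complex_of_real (pulse (bump_diff m p) (m + 2) a d x)"]) blast+
qed

lemma derivative_closed_waves:
  "derivative_closed {\<lambda>s. c * wave p m a d s | c p m a d. d > 0}"
  unfolding derivative_closed_def
proof clarify
  fix c p m a and d :: real assume d: "d > 0"
  have "((\<lambda>s. c * wave p m a d s) has_vector_derivative (c * \<i>) * wave ([:a, d:] * p) m a d s) (at s)" for s
    using has_vector_derivative_mult_right[OF wave_has_vector_derivative[OF d], of c p m a s]
    by (simp only: mult.assoc)
  then show "\<exists>f'\<in>{\<lambda>s. c * wave p m a d s | c p m a d. d > 0}.
     \<forall>x. ((\<lambda>s. c * wave p m a d s) has_vector_derivative f' x) (at x)"
    using d by (intro bexI[of _ "\<lambda>s. (c * \<i>) * wave ([:a, d:] * p) m a d s"]) blast+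
qed

definition pulse_prod :: "real \<Rightarrow> real^'n::finite \<Rightarrow> real^'n \<Rightarrow> real" where
  "pulse_prod d a x = (\<Prod>i\<in>UNIV. pulse 1 0 (a $ i) d (x $ i))"

text \<open>The inverse Fourier transform of \<open>pulse_prod d a\<close>, see \<open>fourier_wave_prod\<close> below.\<close>
definition wave_prod :: "real \<Rightarrow> real^'n::finite \<Rightarrow> real^'n \<Rightarrow> complex" where
  "wave_prod d a \<xi> = (\<Prod>i\<in>UNIV. wave 1 0 (a $ i) d (\<xi> $ i) / (2 * pi))"

lemma pulse_prod_nonneg: "pulse_prod d a x \<ge> 0"
  unfolding pulse_prod_def by (intro prod_nonneg) (auto simp: pulse_1_nonneg)

lemma pulse_prod_eq_0:
  assumes "d > 0" "d \<le> \<bar>x $ i - a $ i\<bar>"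
  shows "pulse_prod d a x = 0"
  unfolding pulse_prod_def using pulse_eq_0[OF assms] by (intro prod_zero) auto

lemma wave_prod_schwartz:
  assumes d: "d > 0"
  shows "wave_prod d a \<in> schwartz_space"
  unfolding wave_prod_def[abs_def]
proof (rule schwartz_prod[OF derivative_closed_waves, of "\<lambda>i s. wave 1 0 (a $ i) d s / (2 * pi)"])
  show "(\<lambda>s. wave 1 0 (a $ i) d s / (2 * pi)) \<in> {\<lambda>s. c * wave p m a d s | c p m a d. d > 0}" for i
    unfolding mem_Collect_eq
    by (rule exI[of _ "1 / (2 * complex_of_real pi)"], rule exI[of _ 1], rule exI[of _ 0], rule exI[of _ "a $ i"], rule exI[of _ d]) (use d in auto)
  fix h k assume "h \<in> {\<lambda>s. c * wave p m a d s | c p m a d. d > 0}"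
  then obtain c p m a d where h: "h = (\<lambda>s. c * wave p m a d s)" "d > 0" by blast
  obtain C where C: "\<And>s. (1 + \<bar>s\<bar>) ^ k * norm (wave p m a d s) \<le> C" using wave_rapid_decay[OF h(2)] by blast
  have "(1 + \<bar>s\<bar>) ^ k * norm (h s) \<le> norm c * C" for s
    using mult_left_mono[OF C[of s], of "norm c"] by (simp add: h(1) norm_mult mult_ac)
  then show "\<exists>C. \<forall>s. (1 + \<bar>s\<bar>) ^ k * norm (h s) \<le> C" by blast
qed

lemma pulse_prod_test_function:
  fixes a :: "real^'n::finite"
  assumes d: "d > 0" and U: "cbox (a - (\<chi> i. d)) (a + (\<chi> i. d)) \<subseteq> U"
  shows "(\<lambda>x. complex_of_real (pulse_prod d a x)) \<in> test_functions U"
proof -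
  let ?B = "cbox (a - (\<chi> i. d)) (a + (\<chi> i. d))"
  have "smooth (\<lambda>x::real^'n. \<Prod>i\<in>UNIV. complex_of_real (pulse 1 0 (a $ i) d (x $ i)))"
  proof (rule smooth_prod[OF derivative_closed_pulses, of "\<lambda>i s. complex_of_real (pulse 1 0 (a $ i) d s)"])
    show "(\<lambda>s. complex_of_real (pulse 1 0 (a $ i) d s)) \<in> {\<lambda>x. c * complex_of_real (pulse p m a d x) | c p m a d. d > 0}" for i
      unfolding mem_Collect_eq
      by (rule exI[of _ 1], rule exI[of _ 1], rule exI[of _ 0], rule exI[of _ "a $ i"], rule exI[of _ d]) (use d in auto)
  qed
  then have "smooth (\<lambda>x. complex_of_real (pulse_prod d a x))" by (simp add: pulse_prod_def)
  moreover have "{x. complex_of_real (pulse_prod d a x) \<noteq> 0} \<subseteq> ?B"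
  proof
    fix x assume "x \<in> {x. complex_of_real (pulse_prod d a x) \<noteq> 0}"
    then have "\<bar>x $ i - a $ i\<bar> < d" for i using pulse_prod_eq_0[OF d, of x i a] by force
    then have "a $ i - d \<le> x $ i \<and> x $ i \<le> a $ i + d" for i by (smt (verit))
    then show "x \<in> ?B" by (simp add: mem_box_cart)
  qed
  then have cl: "closure {x. complex_of_real (pulse_prod d a x) \<noteq> 0} \<subseteq> ?B"
    by (intro closure_minimal) auto
  moreover have "compact (closure {x. complex_of_real (pulse_prod d a x) \<noteq> 0})"
    using cl by (meson bounded_cbox bounded_subset closed_closure compact_eq_bounded_closed)
  ultimately show ?thesis using U by (auto simp: test_functions_def)
qed

section \<open>Heat slices and their uniform decay\<close>

text \<open>The inverse Fourier transform of $\xi_1^2 e^{-t(|\xi|^2 + e\xi_1^4)}$. The parameter $e$ is $1$ for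
  the representation of the kernel; rescaling by $R$ turns it into $1/R^2$, and $e = 0$ is the limit.\<close>
definition heat_slice :: "'n::finite \<Rightarrow> real \<Rightarrow> real \<Rightarrow> real^'n \<Rightarrow> complex" where
  "heat_slice one t e x = (\<Prod>i\<in>UNIV. osc_integral (if i = one then 2 else 0) t (if i = one then t * e else 0) (x $ i) / (2 * pi))"

text \<open>The normalised estimate transported by scaling: $l$ is the length scale on which the larger of the
  two terms of the exponent becomes $1$.\<close>
lemma osc_integral_decay:
  "\<exists>C>0. \<forall>a b l z. 0 < a \<and> 0 \<le> b \<and> 0 < l \<and> a * l\<^sup>2 \<le> 1 \<and> b * l ^ 4 \<le> 1 \<and> (a * l\<^sup>2 = 1 \<or> b * l ^ 4 = 1)
     \<longrightarrow> \<bar>z\<bar> ^ k * norm (osc_integral n a b z) \<le> C * l ^ Suc n / l ^ k"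
proof -
  obtain C where C: "\<And>a b z. 0 < a \<and> a \<le> 1 \<and> 0 \<le> b \<and> b \<le> 1 \<and> (a = 1 \<or> b = 1) \<Longrightarrow> \<bar>z\<bar> ^ k * norm (osc_integral n a b z) \<le> C"
    using osc_integral_decay_normalised[of k n] by blast
  have "\<bar>z\<bar> ^ k * norm (osc_integral n a b z) \<le> max 1 C * l ^ Suc n / l ^ k"
    if h: "0 < a" "0 \<le> b" "0 < l" "a * l\<^sup>2 \<le> 1" "b * l ^ 4 \<le> 1" "a * l\<^sup>2 = 1 \<or> b * l ^ 4 = 1" for a b l z
  proof -
    have "norm (osc_integral n a b z) = l ^ Suc n * norm (osc_integral n (a * l\<^sup>2) (b * l ^ 4) (l * z))"
      by (subst osc_integral_scale[OF h(3)]) (use h(3) in \<open>simp add: norm_mult norm_power\<close>)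
    then have "\<bar>z\<bar> ^ k * norm (osc_integral n a b z) = (l ^ Suc n / l ^ k) * (\<bar>l * z\<bar> ^ k * norm (osc_integral n (a * l\<^sup>2) (b * l ^ 4) (l * z)))"
      using h(3) by (simp add: abs_mult power_mult_distrib)
    also have "\<dots> \<le> (l ^ Suc n / l ^ k) * max 1 C"
      using h C[of "a * l\<^sup>2" "b * l ^ 4" "l * z"] by (intro mult_left_mono) (auto simp: max_def)
    finally show ?thesis by (simp add: mult_ac)
  qed
  then show ?thesis by (intro exI[of _ "max 1 C"]) auto
qed

text \<open>The scale is $l = \min(t^{-1/2}, (te)^{-1/4})$, and the first entry is the smaller one exactly if
  $e \le t$, in particular if $e = 0$. As $e \le 1$, for $t \le 1$ the scale is never shorter than
  $t^{-1/4}$.\<close>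
lemma balanced_scale:
  fixes t e :: real
  assumes t: "t > 0" and e: "0 \<le> e" "e \<le> 1"
  shows "\<exists>l>0. t * l\<^sup>2 \<le> 1 \<and> t * e * l ^ 4 \<le> 1 \<and> (t * l\<^sup>2 = 1 \<or> t * e * l ^ 4 = 1) \<and> (t \<le> 1 \<longrightarrow> 1 \<le> t * l ^ 4)"
proof (cases "e \<le> t")
  case True
  define l where "l = 1 / sqrt t"
  have l: "l > 0" "l\<^sup>2 = 1 / t" using t by (auto simp: l_def power_divide)
  then have l4: "l ^ 4 = 1 / t\<^sup>2" by (metis power_divide power_even_eq mult_2 numeral_Bit0 one_power2 power_mult)
  show ?thesis
  proof (intro exI[of _ l] conjI impI)
    show "l > 0" by fact
    show tl: "t * l\<^sup>2 \<le> 1" "t * l\<^sup>2 = 1 \<or> t * e * l ^ 4 = 1" using t by (simp_all add: l(2))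
    have "t * e * l ^ 4 = e / t" using t by (simp add: l4 power2_eq_square)
    then show "t * e * l ^ 4 \<le> 1" using True t by simp
    have "t * l ^ 4 = 1 / t" using t by (simp add: l4 power2_eq_square)
    then show "1 \<le> t * l ^ 4" if "t \<le> 1" using that t by simp
  qed
next
  case False
  then have te: "t * e > 0" using t by simp
  define l where "l = 1 / sqrt (sqrt (t * e))"
  have l: "l > 0" "l\<^sup>2 = 1 / sqrt (t * e)" using te by (auto simp: l_def power_divide)
  then have l4: "l ^ 4 = 1 / (t * e)" using te by (metis power_divide power_even_eq mult_2 numeral_Bit0 one_power2 power_mult real_sqrt_pow2 less_imp_le)
  have "t = sqrt (t * t)" using t by simp
  also have "\<dots> \<le> sqrt (t * e)" using False t by (intro real_sqrt_le_mono mult_left_mono) auto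
  finally have "t * l\<^sup>2 \<le> 1" using te by (simp add: l(2))
  moreover have "t * l ^ 4 = 1 / e" using t False by (simp add: l4)
  ultimately show ?thesis
    by (intro exI[of _ l]) (use False t e l(1) te in \<open>auto simp: l4\<close>)
qed

text \<open>The first bound controls large $t$. The second shows that away from $z = 0$ the integral vanishes
  to arbitrary order as $t \to 0$, uniformly in $e$; powers of $z$ of the form $3+4j$ are chosen
  so that the scale enters only through $l^{-4j} \le t^j$.\<close>
lemma osc_integral_2_bounds:
  "\<exists>C>0. \<forall>t e z. 0 < t \<and> 0 \<le> e \<and> e \<le> 1 \<longrightarrow>
     norm (osc_integral 2 t (t * e) z) \<le> C * (1 / sqrt t) ^ 3 \<and>
     (t \<le> 1 \<longrightarrow> \<bar>z\<bar> ^ (3 + 4 * j) * norm (osc_integral 2 t (t * e) z) \<le> C * t ^ j)"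
proof -
  obtain C where C: "C > 0" "\<And>a b l z. 0 < a \<and> 0 \<le> b \<and> 0 < l \<and> a * l\<^sup>2 \<le> 1 \<and> b * l ^ 4 \<le> 1 \<and> (a * l\<^sup>2 = 1 \<or> b * l ^ 4 = 1)
     \<Longrightarrow> \<bar>z\<bar> ^ 0 * norm (osc_integral 2 a b z) \<le> C * l ^ Suc 2 / l ^ 0"
    using osc_integral_decay[of 0 2] by blast
  obtain D where D: "D > 0" "\<And>a b l z. 0 < a \<and> 0 \<le> b \<and> 0 < l \<and> a * l\<^sup>2 \<le> 1 \<and> b * l ^ 4 \<le> 1 \<and> (a * l\<^sup>2 = 1 \<or> b * l ^ 4 = 1)
     \<Longrightarrow> \<bar>z\<bar> ^ (3 + 4 * j) * norm (osc_integral 2 a b z) \<le> D * l ^ Suc 2 / l ^ (3 + 4 * j)"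
    using osc_integral_decay[of "3 + 4 * j" 2] by blast
  have "norm (osc_integral 2 t (t * e) z) \<le> max C D * (1 / sqrt t) ^ 3 \<and>
     (t \<le> 1 \<longrightarrow> \<bar>z\<bar> ^ (3 + 4 * j) * norm (osc_integral 2 t (t * e) z) \<le> max C D * t ^ j)"
    if t: "0 < t" and e: "0 \<le> e" "e \<le> 1" for t e z
  proof -
    obtain l where l: "l > 0" "t * l\<^sup>2 \<le> 1" "t * e * l ^ 4 \<le> 1" "t * l\<^sup>2 = 1 \<or> t * e * l ^ 4 = 1" "t \<le> 1 \<Longrightarrow> 1 \<le> t * l ^ 4"
      using balanced_scale[OF t e] by blast
    have "l\<^sup>2 \<le> (1 / sqrt t)\<^sup>2" using l(2) t by (simp add: power_divide field_simps)
    then have "l \<le> 1 / sqrt t" by (rule power2_le_imp_le) (use t in simp)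
    then have l3: "l ^ 3 \<le> (1 / sqrt t) ^ 3" using l(1) by (intro power_mono) auto
    have te: "0 \<le> t * e" using t e by simp
    have "\<bar>z\<bar> ^ 0 * norm (osc_integral 2 t (t * e) z) \<le> C * l ^ Suc 2 / l ^ 0"
      by (rule C(2)) (intro conjI l(1-4) t te)
    then have "norm (osc_integral 2 t (t * e) z) \<le> C * l ^ 3" by (simp add: numeral_3_eq_3)
    also have "\<dots> \<le> max C D * (1 / sqrt t) ^ 3" using C(1) l(1) l3 t by (intro mult_mono) auto
    finally have 1: "norm (osc_integral 2 t (t * e) z) \<le> max C D * (1 / sqrt t) ^ 3" .
    have 2: "\<bar>z\<bar> ^ (3 + 4 * j) * norm (osc_integral 2 t (t * e) z) \<le> max C D * t ^ j" if t1: "t \<le> 1"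
    proof -
      have "1 \<le> (t * l ^ 4) ^ j" using l(5)[OF t1] by (rule one_le_power)
      also have "(t * l ^ 4) ^ j = t ^ j * l ^ (4 * j)" by (simp only: power_mult_distrib power_mult)
      finally have "1 / l ^ (4 * j) \<le> t ^ j" using l(1) by (simp only: divide_le_eq zero_less_power if_True)
      have "\<bar>z\<bar> ^ (3 + 4 * j) * norm (osc_integral 2 t (t * e) z) \<le> D * l ^ Suc 2 / l ^ (3 + 4 * j)"
        by (rule D(2)) (intro conjI l(1-4) t te)
      also have "\<dots> = D * (1 / l ^ (4 * j))" using l(1) by (simp only: power_add) (simp add: numeral_3_eq_3)
      also have "\<dots> \<le> max C D * t ^ j"
        using \<open>1 / l ^ (4 * j) \<le> t ^ j\<close> D(1) l(1) by (intro mult_mono) auto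
      finally show ?thesis .
    qed
    show ?thesis using 1 2 by blast
  qed
  then show ?thesis using C(1) by (intro exI[of _ "max C D"]) auto
qed

lemma norm_osc_integral_0_gauss:
  assumes t: "t > 0"
  shows "norm (osc_integral 0 t 0 z) = sqrt pi * (1 / sqrt t) * exp (- (z\<^sup>2 / (4 * t)))"
  unfolding osc_integral_0_gauss[OF t] norm_of_real using t by (simp add: real_sqrt_divide abs_mult)

lemma osc_integral_0_bounds:
  assumes t: "t > 0"
  shows "norm (osc_integral 0 t 0 z) \<le> sqrt pi * (1 / sqrt t)"
    and "z ^ (2 * j) * norm (osc_integral 0 t 0 z) \<le> fact j * 4 ^ j * t ^ j * (sqrt pi * (1 / sqrt t))"
proof -
  show "norm (osc_integral 0 t 0 z) \<le> sqrt pi * (1 / sqrt t)"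
    unfolding norm_osc_integral_0_gauss[OF t] using t by (intro mult_left_le) auto
  define u where "u = z\<^sup>2 / (4 * t)"
  have "u ^ j / fact j \<le> exp u" using t by (intro power_over_fact_le_exp) (simp add: u_def)
  then have "u ^ j * exp (- u) \<le> fact j"
    by (simp add: exp_minus field_simps)
  then have "(4 * t) ^ j * (u ^ j * exp (- u)) \<le> (4 * t) ^ j * fact j"
    using t by (intro mult_left_mono) auto
  moreover have "(4 * t) ^ j * u ^ j = z ^ (2 * j)"
  proof -
    have "(4 * t) ^ j * u ^ j = (4 * t * u) ^ j" by (rule power_mult_distrib[symmetric])
    also have "4 * t * u = z\<^sup>2" using t by (simp add: u_def)
    finally show ?thesis by (simp add: power_mult)
  qed
  ultimately have "z ^ (2 * j) * exp (- u) \<le> fact j * 4 ^ j * t ^ j"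
    by (simp only: power_mult_distrib mult.assoc[symmetric]) (simp only: mult_ac)
  from mult_right_mono[OF this, of "sqrt pi * (1 / sqrt t)"] t
  show "z ^ (2 * j) * norm (osc_integral 0 t 0 z) \<le> fact j * 4 ^ j * t ^ j * (sqrt pi * (1 / sqrt t))"
    unfolding norm_osc_integral_0_gauss[OF t] u_def by (simp add: mult_ac)
qed

lemma norm_heat_slice_le:
  fixes x :: "real^'n::finite"
  shows "norm (heat_slice one t e x) \<le> norm (osc_integral 2 t (t * e) (x $ one)) * (\<Prod>i\<in>UNIV - {one}. norm (osc_integral 0 t 0 (x $ i)))"
proof -
  have "norm (heat_slice one t e x) = (\<Prod>i\<in>UNIV. norm (osc_integral (if i = one then 2 else 0) t (if i = one then t * e else 0) (x $ i)) / (2 * pi))"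
    unfolding heat_slice_def by (simp add: norm_divide norm_mult flip: prod_norm)
  also have "\<dots> \<le> (\<Prod>i\<in>UNIV. norm (osc_integral (if i = one then 2 else 0) t (if i = one then t * e else 0) (x $ i)))"
  proof (intro prod_mono conjI)
    fix i
    have "1 \<le> 2 * pi" using pi_gt3 by simp
    then show "norm (osc_integral (if i = one then 2 else 0) t (if i = one then t * e else 0) (x $ i)) / (2 * pi)
      \<le> norm (osc_integral (if i = one then 2 else 0) t (if i = one then t * e else 0) (x $ i))"
      by (intro divide_le_eq[THEN iffD2]) (auto simp: mult_le_cancel_left1)
  qed simp
  also have "\<dots> = norm (osc_integral 2 t (t * e) (x $ one)) * (\<Prod>i\<in>UNIV - {one}. norm (osc_integral 0 t 0 (x $ i)))"
    by (subst prod.remove[of UNIV one]) (auto intro!: prod.cong)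
  finally show ?thesis .
qed

text \<open>For $t \ge 1$ the trivial bounds give $t^{-3/2} t^{-(N-1)/2} \le t^{-2}$; this is where $N \ge 2$
  enters. For $t \le 1$ the trivial bounds blow up like a negative power of $t$, and the coordinate
  that is at least $c$ in modulus supplies a positive power of $t$ that compensates: by
  integration by parts if it is the distinguished coordinate, and by the Gaussian factor otherwise.\<close>
lemma heat_slice_bound:
  fixes one :: "'n::finite"
  assumes N: "CARD('n) \<ge> 2" and c: "c > 0"
  shows "\<exists>C. \<forall>t e (x::real^'n). 0 < t \<and> 0 \<le> e \<and> e \<le> 1 \<and> (\<exists>i. c \<le> \<bar>x $ i\<bar>) \<longrightarrow>
     norm (heat_slice one t e x) \<le> C / (1 + t\<^sup>2)"
proof -
  define N where "N = CARD('n)"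
  have card: "card (UNIV - {one}) = N - 1" by (simp add: N_def)
  obtain C where C: "C > 0" and
    C1: "\<And>t e z. 0 < t \<Longrightarrow> 0 \<le> e \<Longrightarrow> e \<le> 1 \<Longrightarrow> norm (osc_integral 2 t (t * e) z) \<le> C * (1 / sqrt t) ^ 3" and
    C2: "\<And>t e z. 0 < t \<Longrightarrow> 0 \<le> e \<Longrightarrow> e \<le> 1 \<Longrightarrow> t \<le> 1 \<Longrightarrow> \<bar>z\<bar> ^ (3 + 4 * N) * norm (osc_integral 2 t (t * e) z) \<le> C * t ^ N"
    using osc_integral_2_bounds[of N] by blast
  have N2: "N \<ge> 2" using N by (simp add: N_def)
  define p where "p = sqrt pi"
  have p: "p \<ge> 1" using pi_gt3 by (simp add: p_def)
  \<comment> \<open>the exponent $N+2$ of $t$ more than offsets the $N+2$ factors $t^{-1/2}$ of the trivial bounds\<close>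
  define G where "G = fact (N + 2) * 4 ^ (N + 2) / c ^ (2 * (N + 2))"
  define A where "A = C * p ^ (N - 1) * (1 + 1 / c ^ (3 + 4 * N) + G)"
  have G: "G > 0" using c by (simp add: G_def)
  have Ap: "C * p ^ (N - 1) \<le> A" "C * p ^ (N - 1) * (1 / c ^ (3 + 4 * N)) \<le> A" "C * p ^ (N - 1) * G \<le> A"
  proof -
    have q: "C * p ^ (N - 1) > 0" using C p by simp
    have r: "1 / c ^ (3 + 4 * N) > 0" using c by simp
    have "C * p ^ (N - 1) * 1 \<le> A" unfolding A_def using q r G by (intro mult_left_mono) linarith+
    then show "C * p ^ (N - 1) \<le> A" by simp
    show "C * p ^ (N - 1) * (1 / c ^ (3 + 4 * N)) \<le> A" unfolding A_def using q r G by (intro mult_left_mono) linarith+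
    show "C * p ^ (N - 1) * G \<le> A" unfolding A_def using q r G by (intro mult_left_mono) linarith+
  qed
  have A0: "A \<ge> 0" using Ap(1) C p by (smt (verit) mult_nonneg_nonneg zero_le_power)
  have "norm (heat_slice one t e x) \<le> (2 * A) / (1 + t\<^sup>2)"
    if t: "0 < t" and e: "0 \<le> e" "e \<le> 1" and x: "\<exists>i. c \<le> \<bar>x $ i\<bar>" for t e and x :: "real^'n"
  proof -
    define r where "r = 1 / sqrt t"
    have r: "r > 0" "t * r\<^sup>2 = 1" using t by (auto simp: r_def power_divide)
    have g: "norm (osc_integral 0 t 0 z) \<le> p * r" for z using osc_integral_0_bounds(1)[OF t] by (simp add: p_def r_def)
    have J: "norm (osc_integral 2 t (t * e) z) \<le> C * r ^ 3" for z using C1[OF t e] by (simp add: r_def)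
    have prodg: "(\<Prod>i\<in>I. norm (osc_integral 0 t 0 (x $ i))) \<le> (p * r) ^ card I" for I
      using prod_mono[of I "\<lambda>i. norm (osc_integral 0 t 0 (x $ i))" "\<lambda>_. p * r"] g by simp
    have hs: "norm (heat_slice one t e x) \<le> X * Y"
      if "norm (osc_integral 2 t (t * e) (x $ one)) \<le> X" "(\<Prod>i\<in>UNIV - {one}. norm (osc_integral 0 t 0 (x $ i))) \<le> Y" for X Y
    proof (rule order_trans[OF norm_heat_slice_le mult_mono[OF that]])
      show "0 \<le> X" using that(1) norm_ge_zero order_trans by blast
    qed (simp add: prod_nonneg)
    show ?thesis
    proof (cases "t \<le> 1")
      case False
      have r1: "r \<le> 1" using False by (simp add: r_def)
      have "norm (heat_slice one t e x) \<le> (C * r ^ 3) * (p * r) ^ (N - 1)"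
        using hs[OF J prodg] unfolding card .
      also have "\<dots> = C * p ^ (N - 1) * r ^ (N + 2)"
      proof -
        have "r ^ 3 * r ^ (N - 1) = r ^ (N + 2)" unfolding power_add[symmetric] using N2 by simp
        then show ?thesis by (simp only: power_mult_distrib mult_ac)
      qed
      also have "\<dots> \<le> A * r ^ 4"
        using N2 r(1) r1 Ap(1) A0 by (intro mult_mono power_decreasing) simp_all
      also have "r ^ 4 = 1 / t\<^sup>2"
      proof -
        have "r\<^sup>2 = 1 / t" using r(2) t by (simp add: field_simps)
        then have "(r\<^sup>2)\<^sup>2 = 1 / t\<^sup>2" by (simp add: power_divide)
        then show ?thesis by simp
      qed
      also have "A * (1 / t\<^sup>2) \<le> (2 * A) / (1 + t\<^sup>2)"
      proof -
        have "1 \<le> t\<^sup>2" using False by (simp add: one_le_power)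
        then have "A * (1 + t\<^sup>2) \<le> A * (2 * t\<^sup>2)" using A0 by (intro mult_left_mono) auto
        then show ?thesis using t by (simp add: field_simps add_pos_pos)
      qed
      finally show ?thesis .
    next
      case True
      have r1: "1 \<le> r" using t True by (simp add: r_def)
      have tr: "t ^ m * r ^ k \<le> 1" if "k \<le> 2 * m" for k m
      proof -
        have "t ^ m * r ^ k \<le> t ^ m * r ^ (2 * m)" using t r1 that by (intro mult_left_mono power_increasing) auto
        also have "\<dots> = 1" using r(2) by (simp add: power_mult flip: power_mult_distrib)
        finally show ?thesis .
      qed
      obtain i where i: "c \<le> \<bar>x $ i\<bar>" using x by blast
      have "norm (heat_slice one t e x) \<le> A"
      proof (cases "i = one")
        case i1: True
        have "c ^ (3 + 4 * N) * norm (osc_integral 2 t (t * e) (x $ one)) \<le> \<bar>x $ one\<bar> ^ (3 + 4 * N) * norm (osc_integral 2 t (t * e) (x $ one))"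
          using i i1 c by (intro mult_right_mono power_mono) auto
        also have "\<dots> \<le> C * t ^ N" by (rule C2[OF t e True])
        finally have "norm (osc_integral 2 t (t * e) (x $ one)) \<le> (C * t ^ N) * (1 / c ^ (3 + 4 * N))"
          using c by (simp add: field_simps)
        then have "norm (heat_slice one t e x) \<le> ((C * t ^ N) * (1 / c ^ (3 + 4 * N))) * (p * r) ^ (N - 1)"
          using hs[OF _ prodg] unfolding card by blast
        also have "\<dots> = (C * p ^ (N - 1) * (1 / c ^ (3 + 4 * N))) * (t ^ N * r ^ (N - 1))"
          by (simp add: power_mult_distrib mult_ac)
        also have "\<dots> \<le> (C * p ^ (N - 1) * (1 / c ^ (3 + 4 * N))) * 1"
          using C p c by (intro mult_left_mono tr) auto
        finally show ?thesis using Ap(2) by simp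
      next
        case i2: False
        have "c ^ (2 * (N + 2)) \<le> (x $ i) ^ (2 * (N + 2))"
          using i c power_mono[of c "\<bar>x $ i\<bar>" "2 * (N + 2)"] by (simp add: power_even_abs)
        then have "c ^ (2 * (N + 2)) * norm (osc_integral 0 t 0 (x $ i)) \<le> (x $ i) ^ (2 * (N + 2)) * norm (osc_integral 0 t 0 (x $ i))"
          by (rule mult_right_mono) simp
        also have "\<dots> \<le> fact (N + 2) * 4 ^ (N + 2) * t ^ (N + 2) * (p * r)"
          using osc_integral_0_bounds(2)[OF t, of "x $ i" "N + 2"] by (simp only: p_def r_def)
        finally have gi: "norm (osc_integral 0 t 0 (x $ i)) \<le> G * t ^ (N + 2) * (p * r)"
          using c by (simp add: G_def pos_le_divide_eq mult_ac del: fact_Suc power_Suc add_2_eq_Suc')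
        have "(\<Prod>i\<in>UNIV - {one}. norm (osc_integral 0 t 0 (x $ i))) =
           norm (osc_integral 0 t 0 (x $ i)) * (\<Prod>i\<in>UNIV - {one} - {i}. norm (osc_integral 0 t 0 (x $ i)))"
          using i2 by (subst prod.remove[of _ i]) auto
        also have "\<dots> \<le> (G * t ^ (N + 2) * (p * r)) * (p * r) ^ card (UNIV - {one} - {i})"
          using gi prodg G t p r(1) by (intro mult_mono) (auto intro: prod_nonneg)
        also have "card (UNIV - {one} - {i}) = N - 2" using i2 by (simp add: N_def)
        finally have "norm (heat_slice one t e x) \<le> (C * r ^ 3) * ((G * t ^ (N + 2) * (p * r)) * (p * r) ^ (N - 2))"
          by (rule hs[OF J])
        also have "(p * r) * (p * r) ^ (N - 2) = (p * r) ^ (N - 1)"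
          using N2 by (simp flip: power_Suc add: Suc_diff_Suc numeral_2_eq_2)
        then have "(C * r ^ 3) * ((G * t ^ (N + 2) * (p * r)) * (p * r) ^ (N - 2)) = (C * r ^ 3) * (G * t ^ (N + 2) * (p * r) ^ (N - 1))"
          by (simp only: mult.assoc)
        also have "\<dots> = (C * p ^ (N - 1) * G) * (t ^ (N + 2) * (r ^ 3 * r ^ (N - 1)))"
          by (simp add: power_mult_distrib mult_ac)
        also have "\<dots> \<le> (C * p ^ (N - 1) * G) * 1"
          using C p G tr[of "3 + (N - 1)" "N + 2"] N by (intro mult_left_mono) (auto simp: N_def simp flip: power_add)
        finally show ?thesis using Ap(3) by simp
      qed
      also have "A \<le> (2 * A) / (1 + t\<^sup>2)"
      proof -
        have "t\<^sup>2 \<le> 1" using t True by (simp add: power_le_one)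
        then have "A * (1 + t\<^sup>2) \<le> A * 2" using A0 by (intro mult_left_mono) auto
        then show ?thesis using t by (simp add: field_simps add_pos_pos)
      qed
      finally show ?thesis .
    qed
  qed
  then show ?thesis by blast
qed

lemma set_integrable_one_plus_square: "set_integrable lborel {0<..} (\<lambda>t::real. C / (1 + t\<^sup>2))"
  using integrable_I0i_1_div_plus_square set_integrable_mult_right[of C lborel "{0<..}" "\<lambda>t. 1 / (1 + t\<^sup>2)"]
  by (simp add: interval_integrable_to_infinity_eq zero_ereal_def)

lemma measurable_osc_integral [measurable (raw)]:
  assumes [measurable]: "a \<in> borel_measurable M" "b \<in> borel_measurable M" "z \<in> borel_measurable M"
  shows "(\<lambda>w. osc_integral n (a w) (b w) (z w)) \<in> borel_measurable M"
  unfolding osc_integral_def by measurable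

lemma measurable_heat_slice [measurable (raw)]:
  assumes [measurable]: "t \<in> borel_measurable M" "x \<in> borel_measurable M"
  shows "(\<lambda>w. heat_slice one (t w) e (x w)) \<in> borel_measurable M"
proof -
  have [measurable]: "(\<lambda>w. x w $ i) \<in> borel_measurable M" for i
    by (rule measurable_compose[OF assms(2)]) (intro borel_measurable_continuous_onI continuous_intros)
  show ?thesis
    unfolding heat_slice_def by (intro borel_measurable_prod borel_measurable_divide measurable_osc_integral) simp_all
qed

lemma heat_slice_tendsto:
  fixes x :: "nat \<Rightarrow> real^'n::finite"
  assumes t: "t > 0" and e: "\<And>k. e k \<ge> 0" "e \<longlonglongrightarrow> e'" and x: "x \<longlonglongrightarrow> x'"
  shows "(\<lambda>k. heat_slice one t (e k) (x k)) \<longlonglongrightarrow> heat_slice one t e' x'"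
  unfolding heat_slice_def
proof (intro tendsto_prod tendsto_divide tendsto_const)
  fix i
  have te: "(\<lambda>k. if i = one then t * e k else 0) \<longlonglongrightarrow> (if i = one then t * e' else 0)"
    using e(2) by (auto intro!: tendsto_intros)
  show "(\<lambda>k. osc_integral (if i = one then 2 else 0) t (if i = one then t * e k else 0) (x k $ i)) \<longlonglongrightarrow>
     osc_integral (if i = one then 2 else 0) t (if i = one then t * e' else 0) (x' $ i)"
    by (rule osc_integral_tendsto[OF t _ te]) (use e(1) t x in \<open>auto intro: tendsto_vec_nth\<close>)
qed (use pi_gt_zero in auto)

section \<open>The kernel as an integral of heat slices\<close>

text \<open>The Fourier multiplier of \<open>heat_slice one t 1\<close>, as a product over the coordinates.\<close>
definition slice_symbol :: "'n::finite \<Rightarrow> real \<Rightarrow> real^'n \<Rightarrow> real" where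
  "slice_symbol one t \<xi> = (\<Prod>i\<in>UNIV. damped_power (if i = one then 2 else 0) t (if i = one then t else 0) (\<xi> $ i))"

lemma slice_symbol_eq:
  "slice_symbol one t \<xi> = (\<xi> $ one)\<^sup>2 * exp (- (t * ((norm \<xi>)\<^sup>2 + (\<xi> $ one) ^ 4)))"
proof -
  have "slice_symbol one t \<xi> = (\<Prod>i\<in>UNIV. (if i = one then (\<xi> $ one)\<^sup>2 * exp (- (t * (\<xi> $ one) ^ 4)) else 1) * exp (- (t * (\<xi> $ i)\<^sup>2)))"
    unfolding slice_symbol_def damped_power_def by (intro prod.cong) (auto simp: exp_diff exp_minus field_simps)
  also have "\<dots> = (\<xi> $ one)\<^sup>2 * exp (- (t * (\<xi> $ one) ^ 4)) * (\<Prod>i\<in>UNIV. exp (- (t * (\<xi> $ i)\<^sup>2)))"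
    by (simp add: prod.distrib)
  also have "(\<Prod>i\<in>UNIV. exp (- (t * (\<xi> $ i)\<^sup>2))) = exp (\<Sum>i\<in>UNIV. - (t * (\<xi> $ i)\<^sup>2))"
    by (simp add: exp_sum)
  also have "(\<Sum>i\<in>UNIV. - (t * (\<xi> $ i)\<^sup>2)) = - (t * (norm \<xi>)\<^sup>2)"
    by (simp add: sum_negf norm_vec_def L2_set_def sum_nonneg flip: sum_distrib_left)
  finally show ?thesis by (simp add: algebra_simps flip: exp_add)
qed

lemma K0_hat_bounds: "0 \<le> K0_hat one \<xi>" "K0_hat one \<xi> \<le> 1"
proof -
  have "(\<xi> $ one)\<^sup>2 \<le> (norm \<xi>)\<^sup>2" using component_le_norm_cart[of \<xi> one] by (metis abs_le_square_iff abs_norm_cancel)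
  then have "(\<xi> $ one)\<^sup>2 \<le> (norm \<xi>)\<^sup>2 + (\<xi> $ one) ^ 4" by (simp add: add_increasing2)
  moreover have "0 \<le> (norm \<xi>)\<^sup>2 + (\<xi> $ one) ^ 4" by simp
  ultimately show "K0_hat one \<xi> \<le> 1" unfolding K0_hat_def divide_le_eq_1 by linarith
  show "0 \<le> K0_hat one \<xi>" unfolding K0_hat_def by simp
qed

text \<open>Where $\xi_1 = 0$ both sides vanish, which covers the origin as well; elsewhere
  $|\xi|^2 + \xi_1^4 > 0$ and the exponential integral applies.\<close>
lemma slice_symbol_integral:
  shows "set_integrable lborel {0<..} (\<lambda>t. slice_symbol one t \<xi>)"
    and "(LINT t:{0<..}|lborel. slice_symbol one t \<xi>) = K0_hat one \<xi>"
proof -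
  have "set_integrable lborel {0<..} (\<lambda>t. slice_symbol one t \<xi>) \<and> (LINT t:{0<..}|lborel. slice_symbol one t \<xi>) = K0_hat one \<xi>"
  proof (cases "\<xi> $ one = 0")
    case True
    then show ?thesis by (simp add: slice_symbol_eq K0_hat_def set_integrable_def set_lebesgue_integral_def)
  next
    case False
    define A where "A = (norm \<xi>)\<^sup>2 + (\<xi> $ one) ^ 4"
    have A: "A > 0" unfolding A_def using False by (intro add_nonneg_pos) auto
    have "(LINT t:{0<..}|lborel. exp (- (t * A))) = 1 / A"
      using LBINT_I0i_exp_mscale[OF A] by (simp add: interval_integral_to_infinity_eq zero_ereal_def)
    then show ?thesis
      unfolding slice_symbol_eq K0_hat_def using integrable_I0i_exp_mscale[OF A] by (simp flip: A_def)
  qed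
  then show "set_integrable lborel {0<..} (\<lambda>t. slice_symbol one t \<xi>)"
    "(LINT t:{0<..}|lborel. slice_symbol one t \<xi>) = K0_hat one \<xi>" by auto
qed

lemma measurable_slice_symbol [measurable (raw)]:
  assumes [measurable]: "t \<in> borel_measurable M" "x \<in> borel_measurable M"
  shows "(\<lambda>w. slice_symbol one (t w) (x w)) \<in> borel_measurable M"
  unfolding slice_symbol_eq
proof -
  have [measurable]: "(\<lambda>w. x w $ i) \<in> borel_measurable M" for i
    by (rule measurable_compose[OF assms(2)]) (intro borel_measurable_continuous_onI continuous_intros)
  show "(\<lambda>w. (x w $ one)\<^sup>2 * exp (- (t w * ((norm (x w))\<^sup>2 + x w $ one ^ 4)))) \<in> borel_measurable M" by measurable
qed

lemma fourier_wave_prod: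
  fixes a :: "real^'n::finite"
  assumes d: "d > 0"
  shows "fourier (wave_prod d a) = (\<lambda>x. complex_of_real (pulse_prod d a x))"
proof
  fix x :: "real^'n"
  have "wave_prod d a \<xi> * exp (- \<i> * complex_of_real (\<xi> \<bullet> x)) =
     (\<Prod>i\<in>UNIV. (1 / (2 * pi)) * (wave 1 0 (a $ i) d (\<xi> $ i) * iexp (- (\<xi> $ i * x $ i))))" for \<xi>
  proof -
    have "- \<i> * complex_of_real (\<xi> \<bullet> x) = (\<Sum>i\<in>UNIV. \<i> * complex_of_real (- (\<xi> $ i * x $ i)))"
      by (simp add: inner_vec_def sum_negf sum_distrib_left)
    then have "exp (- \<i> * complex_of_real (\<xi> \<bullet> x)) = (\<Prod>i\<in>UNIV. iexp (- (\<xi> $ i * x $ i)))"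
      by (simp only: exp_sum finite)
    then show ?thesis
      unfolding wave_prod_def by (simp only: prod.distrib[symmetric]) (intro prod.cong refl, simp)
  qed
  then have "fourier (wave_prod d a) x = (LINT \<xi>|lborel. (\<Prod>i\<in>UNIV. (1 / (2 * pi)) * (wave 1 0 (a $ i) d (\<xi> $ i) * iexp (- (\<xi> $ i * x $ i)))))"
    unfolding fourier_def by simp
  also have "\<dots> = (\<Prod>i\<in>UNIV. CLINT s|lborel. (1 / (2 * pi)) * (wave 1 0 (a $ i) d s * iexp (- (s * x $ i))))"
  proof (rule integral_prod_cart)
    fix i
    have "complex_integrable lborel (\<lambda>s. wave 1 0 (a $ i) d s * iexp (- (s * x $ i)))"
      by (rule Bochner_Integration.integrable_bound[OF integrable_wave[OF d, of 1 0 "a $ i"]])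
         (use borel_measurable_integrable[OF integrable_wave[OF d, of 1 0 "a $ i"]] in \<open>auto simp: norm_mult\<close>)
    then show "complex_integrable lborel (\<lambda>s. (1 / (2 * pi)) * (wave 1 0 (a $ i) d s * iexp (- (s * x $ i))))"
      by (rule integrable_mult_right)
  qed
  also have "\<dots> = (\<Prod>i\<in>UNIV. complex_of_real (pulse 1 0 (a $ i) d (x $ i)))"
    by (intro prod.cong refl) (simp only: integral_mult_right_zero wave_inversion[OF d], simp)
  finally show "fourier (wave_prod d a) x = complex_of_real (pulse_prod d a x)" by (simp add: pulse_prod_def)
qed

lemma integrable_wave_prod:
  assumes d: "d > 0"
  shows "integrable lborel (wave_prod d a)"
  unfolding wave_prod_def[abs_def]
  by (rule integrable_prod_cart) (intro integrable_divide_zero integrable_wave d)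

text \<open>For fixed $t$ both integrals factor over the coordinates, and in each coordinate the identity is the
  multiplication formula on the line.\<close>
lemma slice_pairing:
  fixes a :: "real^'n::finite"
  assumes d: "d > 0" and t: "t > 0"
  shows "(LINT \<xi>|lborel. complex_of_real (slice_symbol one t \<xi>) * wave_prod d a \<xi>) =
    (LINT x|lborel. heat_slice one t 1 x * complex_of_real (pulse_prod d a x))"
proof -
  define n where "n i = (if i = one then 2 else 0::nat)" for i
  define b where "b i = (if i = one then t else 0)" for i
  have b: "b i \<ge> 0" for i using t by (simp add: b_def)
  define m where "m i s = complex_of_real (damped_power (n i) t (b i) s)" for i s
  have m: "complex_integrable lborel (m i)" for i
    unfolding m_def[abs_def] using integrable_damped_power[OF t b] by simp
  have mi: "(CLINT s|lborel. m i s * iexp (s * y)) = osc_integral (n i) t (b i) y" for i y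
    by (simp add: m_def osc_integral_def)
  let ?p = "\<lambda>i s. complex_of_real (pulse 1 0 (a $ i) d s)"
  have pm: "complex_integrable lborel (\<lambda>y. ?p i y * osc_integral (n i) t (b i) y)" for i
  proof (rule Bochner_Integration.integrable_bound)
    let ?B = "LINT s|lborel. \<bar>damped_power (n i) t (b i) s\<bar>"
    show "integrable lborel (\<lambda>y. ?B * pulse 1 0 (a $ i) d y)" by (intro integrable_mult_right integrable_pulse d)
    have [measurable]: "pulse 1 0 (a $ i) d \<in> borel_measurable borel" using integrable_pulse[OF d] by (auto simp: borel_measurable_integrable)
    show "(\<lambda>y. ?p i y * osc_integral (n i) t (b i) y) \<in> borel_measurable lborel" by measurable
    show "AE y in lborel. norm (?p i y * osc_integral (n i) t (b i) y) \<le> norm (?B * pulse 1 0 (a $ i) d y)"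
    proof (intro AE_I2)
      fix y
      have "norm (?p i y * osc_integral (n i) t (b i) y) \<le> \<bar>pulse 1 0 (a $ i) d y\<bar> * ?B"
        unfolding norm_mult norm_of_real by (intro mult_left_mono norm_osc_integral_le t b) simp
      also have "\<dots> \<le> norm (?B * pulse 1 0 (a $ i) d y)" by (simp add: abs_mult)
      finally show "norm (?p i y * osc_integral (n i) t (b i) y) \<le> norm (?B * pulse 1 0 (a $ i) d y)" .
    qed
  qed
  have wm: "complex_integrable lborel (\<lambda>s. m i s * wave 1 0 (a $ i) d s)" for i
  proof -
    let ?B = "LINT s|lborel. \<bar>pulse 1 0 (a $ i) d s\<bar>"
    have [measurable]: "m i \<in> borel_measurable borel" "wave 1 0 (a $ i) d \<in> borel_measurable borel"
      using m integrable_wave[OF d] by (auto simp: borel_measurable_integrable)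
    have B: "norm (wave 1 0 (a $ i) d s) \<le> ?B" for s
      unfolding wave_def by (rule order_trans[OF integral_norm_bound]) (simp add: norm_mult)
    show ?thesis
    proof (rule Bochner_Integration.integrable_bound)
      show "complex_integrable lborel (\<lambda>s. m i s * ?B)" by (intro integrable_mult_left m)
      show "AE s in lborel. norm (m i s * wave 1 0 (a $ i) d s) \<le> norm (m i s * ?B)"
      proof (intro AE_I2)
        fix s
        have "norm (m i s * wave 1 0 (a $ i) d s) \<le> norm (m i s) * ?B"
          unfolding norm_mult by (intro mult_left_mono B) simp
        also have "\<dots> \<le> norm (m i s * ?B)" by (simp add: norm_mult mult_left_mono)
        finally show "norm (m i s * wave 1 0 (a $ i) d s) \<le> norm (m i s * ?B)" .
      qed
    qed measurable
  qed
  have "(LINT \<xi>|lborel. complex_of_real (slice_symbol one t \<xi>) * wave_prod d a \<xi>) =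
    (LINT \<xi>|lborel. (\<Prod>i\<in>UNIV. m i (\<xi> $ i) * wave 1 0 (a $ i) d (\<xi> $ i) / (2 * pi)))"
    by (simp add: slice_symbol_def wave_prod_def m_def n_def b_def flip: prod.distrib)
  also have "\<dots> = (\<Prod>i\<in>UNIV. CLINT s|lborel. m i s * wave 1 0 (a $ i) d s / (2 * pi))"
    by (rule integral_prod_cart) (intro integrable_divide_zero wm)
  also have "\<dots> = (\<Prod>i\<in>UNIV. CLINT y|lborel. ?p i y * osc_integral (n i) t (b i) y / (2 * pi))"
  proof (intro prod.cong refl)
    fix i
    have "(CLINT s|lborel. m i s * wave 1 0 (a $ i) d s) = (CLINT y|lborel. ?p i y * osc_integral (n i) t (b i) y)"
      unfolding wave_def mi[symmetric]
      by (rule Fourier_multiplication_formula[OF m]) (simp add: integrable_pulse[OF d])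
    then show "(CLINT s|lborel. m i s * wave 1 0 (a $ i) d s / (2 * pi)) = (CLINT y|lborel. ?p i y * osc_integral (n i) t (b i) y / (2 * pi))"
      by (simp only: integral_divide_zero)
  qed
  also have "\<dots> = (LINT x|lborel. (\<Prod>i\<in>UNIV. ?p i (x $ i) * osc_integral (n i) t (b i) (x $ i) / (2 * pi)))"
    by (rule integral_prod_cart[symmetric]) (intro integrable_divide_zero pm)
  also have "\<dots> = (LINT x|lborel. heat_slice one t 1 x * complex_of_real (pulse_prod d a x))"
    by (simp add: heat_slice_def pulse_prod_def n_def b_def mult.commute flip: prod.distrib cong: if_cong)
  finally show ?thesis .
qed

text \<open>Fubini in $(\xi, t)$: the multiplier is bounded by $1$ and the slice symbols are nonnegative, so the
  integrability of \<open>wave_prod d a\<close> is enough. The inner integral is then moved to the space side.\<close>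
lemma K0_hat_pairing:
  fixes a :: "real^'n::finite"
  assumes d: "d > 0"
  shows "regular_distr (\<lambda>\<xi>. complex_of_real (K0_hat one \<xi>)) (wave_prod d a) =
     (LINT t:{0<..}|lborel. LINT x|lborel. heat_slice one t 1 x * complex_of_real (pulse_prod d a x))"
proof -
  let ?g = "wave_prod d a"
  have [measurable]: "?g \<in> borel_measurable borel" using borel_measurable_integrable[OF integrable_wave_prod[OF d, of a]] by simp
  define h where "h \<xi> t = indicator {0<..} t *\<^sub>R (complex_of_real (slice_symbol one t \<xi>) * ?g \<xi>)" for \<xi> t
  have s0: "0 \<le> slice_symbol one t \<xi>" for t \<xi> by (simp add: slice_symbol_eq)
  have K: "(\<lambda>\<xi>. K0_hat one \<xi>) \<in> borel_measurable borel"
  proof -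
    have [measurable]: "(\<lambda>\<xi>::real^'n. \<xi> $ one) \<in> borel_measurable borel"
      by (intro borel_measurable_continuous_onI continuous_intros)
    show ?thesis unfolding K0_hat_def by measurable
  qed
  have Kg: "complex_integrable lborel (\<lambda>\<xi>. complex_of_real (K0_hat one \<xi>) * ?g \<xi>)"
    by (rule Bochner_Integration.integrable_bound[OF integrable_wave_prod[OF d, of a]])
       (use K K0_hat_bounds[of one] in \<open>auto simp: norm_mult intro!: mult_left_le_one_le\<close>)
  have si: "integrable lborel (\<lambda>t. indicator {0<..} t *\<^sub>R slice_symbol one t \<xi>)" for \<xi>
    using slice_symbol_integral(1)[of one \<xi>] by (simp add: set_integrable_def)
  have sv: "(LINT t|lborel. indicator {0<..} t *\<^sub>R slice_symbol one t \<xi>) = K0_hat one \<xi>" for \<xi>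
    using slice_symbol_integral(2)[of one \<xi>] by (simp only: set_lebesgue_integral_def)
  have heq: "h \<xi> t = complex_of_real (indicator {0<..} t *\<^sub>R slice_symbol one t \<xi>) * ?g \<xi>" for \<xi> t
    by (simp add: h_def scaleR_conv_of_real)
  have nh: "norm (h \<xi> t) = (indicator {0<..} t *\<^sub>R slice_symbol one t \<xi>) * norm (?g \<xi>)" for \<xi> t
    unfolding heq norm_mult norm_of_real by (simp add: s0)
  have int: "integrable (lborel \<Otimes>\<^sub>M lborel) (case_prod h)"
  proof (rule lborel_pair.Fubini_integrable)
    show "case_prod h \<in> borel_measurable (lborel \<Otimes>\<^sub>M lborel)" unfolding h_def by measurable
    have "(LINT t|lborel. norm (h \<xi> t)) = K0_hat one \<xi> * norm (?g \<xi>)" for \<xi>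
      unfolding nh by (simp only: integral_mult_left_zero sv)
    moreover have "integrable lborel (\<lambda>\<xi>. K0_hat one \<xi> * norm (?g \<xi>))"
      using integrable_norm[OF Kg] K0_hat_bounds(1)[of one] by (simp add: norm_mult)
    ultimately show "integrable lborel (\<lambda>\<xi>. LINT t|lborel. norm (case_prod h (\<xi>, t)))" by simp
    show "AE \<xi> in lborel. complex_integrable lborel (\<lambda>t. case_prod h (\<xi>, t))"
      unfolding case_prod_conv heq by (intro AE_I2 integrable_mult_left integrable_of_real si)
  qed
  have "regular_distr (\<lambda>\<xi>. complex_of_real (K0_hat one \<xi>)) ?g = (LINT \<xi>|lborel. LINT t|lborel. h \<xi> t)"
    unfolding regular_distr_def heq by (simp only: integral_mult_left_zero integral_complex_of_real sv)
  also have "\<dots> = (LINT t|lborel. LINT \<xi>|lborel. h \<xi> t)"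
    by (rule lborel_pair.Fubini_integral[OF int, symmetric])
  also have "\<dots> = (LINT t:{0<..}|lborel. LINT x|lborel. heat_slice one t 1 x * complex_of_real (pulse_prod d a x))"
    unfolding set_lebesgue_integral_def
  proof (intro Bochner_Integration.integral_cong refl)
    fix t :: real
    show "(LINT \<xi>|lborel. h \<xi> t) = indicator {0<..} t *\<^sub>R (LINT x|lborel. heat_slice one t 1 x * complex_of_real (pulse_prod d a x))"
      unfolding h_def using slice_pairing[OF d, of t one a] by (cases "t > 0") auto
  qed
  finally show ?thesis .
qed

definition cube :: "real^'n::finite \<Rightarrow> real \<Rightarrow> (real^'n) set" where
  "cube a d = cbox (a - (\<chi> i. d)) (a + (\<chi> i. d))"

lemma mem_cube: "x \<in> cube a d \<longleftrightarrow> (\<forall>i. \<bar>x $ i - a $ i\<bar> \<le> d)"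
  by (auto simp: cube_def mem_box_cart abs_le_iff) (smt (verit))+

lemma
  fixes a :: "real^'n::finite"
  assumes d: "d > 0"
  shows integrable_pulse_prod: "integrable lborel (pulse_prod d a)"
    and integral_pulse_prod_pos: "0 < (LINT x|lborel. pulse_prod d a x)"
proof -
  have i: "complex_integrable lborel (\<lambda>s. complex_of_real (pulse 1 0 (a $ i) d s))" for i
    using integrable_pulse[OF d] by simp
  have "complex_integrable lborel (\<lambda>x. complex_of_real (pulse_prod d a x))"
    using integrable_prod_cart[OF i] by (simp add: pulse_prod_def)
  then show "integrable lborel (pulse_prod d a)" by (simp add: complex_of_real_integrable_eq)
  have "complex_of_real (LINT x|lborel. pulse_prod d a x) = complex_of_real (\<Prod>i\<in>UNIV. LINT s|lborel. pulse 1 0 (a $ i) d s)"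
    using integral_prod_cart[OF i] by (simp add: pulse_prod_def flip: integral_complex_of_real)
  then have "(LINT x|lborel. pulse_prod d a x) = (\<Prod>i\<in>UNIV. LINT s|lborel. pulse 1 0 (a $ i) d s)"
    by (simp only: of_real_eq_iff)
  then show "0 < (LINT x|lborel. pulse_prod d a x)" by (simp add: prod_pos integral_pulse_pos[OF d])
qed

lemma pulse_prod_outside_cube:
  assumes d: "d > 0" and "x \<notin> cube a d"
  shows "pulse_prod d a x = 0"
  using assms(2) by (auto simp: mem_cube not_le intro: pulse_prod_eq_0[OF d] less_imp_le)

lemma integrable_mult_pulse_prod:
  fixes F :: "real^'n::finite \<Rightarrow> complex"
  assumes d: "d > 0" and F: "continuous_on (cube a d) F"
  shows "integrable lborel (\<lambda>x. F x * complex_of_real (pulse_prod d a x))"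
proof -
  have "continuous_on (cube a d) (\<lambda>x. pulse 1 0 (a $ i) d (x $ i))" for i
    by (rule continuous_on_compose2[OF continuous_pulse[OF d, of UNIV]]) (auto intro!: continuous_intros)
  then have "continuous_on (cube a d) (pulse_prod d a)"
    unfolding pulse_prod_def[abs_def] by (intro continuous_on_prod)
  then have "integrable lborel (\<lambda>x. indicator (cube a d) x *\<^sub>R (F x * complex_of_real (pulse_prod d a x)))"
    using F by (intro borel_integrable_compact continuous_intros) (simp_all add: cube_def)
  moreover have "indicator (cube a d) x *\<^sub>R (F x * complex_of_real (pulse_prod d a x)) = F x * complex_of_real (pulse_prod d a x)" for x
    by (cases "x \<in> cube a d") (auto simp: pulse_prod_outside_cube[OF d])
  ultimately show ?thesis by (simp only:)
qed

definition mean_pulse :: "real \<Rightarrow> real^'n::finite \<Rightarrow> real^'n \<Rightarrow> real" where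
  "mean_pulse d a x = pulse_prod d a x / (LINT x|lborel. pulse_prod d a x)"

lemma mean_pulse_nonneg: "mean_pulse d a x \<ge> 0"
  unfolding mean_pulse_def by (simp add: pulse_prod_nonneg)

lemma integrable_mean_pulse: "d > 0 \<Longrightarrow> integrable lborel (mean_pulse d a)"
  unfolding mean_pulse_def[abs_def] by (intro integrable_divide_zero integrable_pulse_prod)

lemma integral_mean_pulse: "d > 0 \<Longrightarrow> (LINT x|lborel. mean_pulse d a x) = 1"
  unfolding mean_pulse_def using integral_pulse_prod_pos[of d a] by simp

lemma integrable_mult_mean_pulse:
  fixes F :: "real^'n::finite \<Rightarrow> complex"
  assumes d: "d > 0" and F: "continuous_on (cube a d) F"
  shows "integrable lborel (\<lambda>x. F x * complex_of_real (mean_pulse d a x))"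
  using integrable_divide_zero[OF integrable_mult_pulse_prod[OF assms], of "complex_of_real (LINT x|lborel. pulse_prod d a x)"]
  by (simp add: mean_pulse_def)

lemma mean_pulse_tendsto:
  fixes F :: "real^'n::finite \<Rightarrow> complex"
  assumes d: "\<And>k. d k > 0" "d \<longlonglongrightarrow> 0" and F: "\<And>k::nat. continuous_on (cube a (d k)) F" "isCont F a"
  shows "(\<lambda>k. LINT x|lborel. F x * complex_of_real (mean_pulse (d k) a x)) \<longlonglongrightarrow> F a"
proof (rule approximate_identity[OF F(2), where \<delta>="\<lambda>k. real CARD('n) * d k"])
  show "(\<lambda>k. real CARD('n) * d k) \<longlonglongrightarrow> 0" using tendsto_mult_right_zero[OF d(2)] by simp
  fix k x assume "mean_pulse (d k) a x \<noteq> 0"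
  then have "x \<in> cube a (d k)" using pulse_prod_outside_cube[OF d(1)] by (auto simp: mean_pulse_def)
  have "dist x a \<le> (\<Sum>i\<in>UNIV. \<bar>(x - a) $ i\<bar>)" unfolding dist_norm by (rule norm_le_l1_cart)
  also have "\<dots> \<le> (\<Sum>i\<in>(UNIV::'n set). d k)"
    using \<open>x \<in> cube a (d k)\<close> by (intro sum_mono) (simp add: mem_cube)
  finally show "dist x a \<le> real CARD('n) * d k" by simp
qed (use d F in \<open>auto intro: mean_pulse_nonneg integrable_mean_pulse integral_mean_pulse integrable_mult_mean_pulse\<close>)

lemma isCont_heat_slice:
  assumes "t > 0" "e \<ge> 0"
  shows "isCont (heat_slice one t e) x"
  unfolding continuous_at_sequentially comp_def
  using heat_slice_tendsto[OF assms(1), of "\<lambda>_. e" e] assms(2) by auto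

text \<open>Pair both sides with normalised bumps shrinking to the point. All bumps stay in the region where one fixed
  coordinate of $x_0$ is bounded away from $0$, so \<open>heat_slice_bound\<close> dominates the
  averaged slices uniformly.\<close>
theorem K0_eq_integral_heat_slice:
  fixes one :: "'n::finite" and K0 :: "real^'n \<Rightarrow> complex"
  assumes N: "CARD('n) \<ge> 2"
    and T: "\<forall>f\<in>schwartz_space.
           distr_fourier K0_distr f = regular_distr (\<lambda>\<xi>. complex_of_real (K0_hat one \<xi>)) f"
    and K0: "restricts_to_continuous K0_distr (- {0}) K0"
    and x0: "x0 \<noteq> 0"
  shows "K0 x0 = (LINT t:{0<..}|lborel. heat_slice one t 1 x0)"
proof -
  obtain j where j: "x0 $ j \<noteq> 0" using x0 by (auto simp: vec_eq_iff)
  \<comment> \<open>cubes of half-width at most $c$ around $x_0$ stay at distance at least $c$ from the hyperplane $x_j = 0$\<close>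
  define c where "c = \<bar>x0 $ j\<bar> / 2"
  have c: "c > 0" using j by (simp add: c_def)
  define d where "d k = c * inverse (real (Suc k))" for k
  have d: "d k > 0" "d k \<le> c" for k using c by (auto simp: d_def field_simps)
  have d0: "d \<longlonglongrightarrow> 0" unfolding d_def using tendsto_mult_right_zero[OF LIMSEQ_inverse_real_of_nat] by simp
  have far: "c \<le> \<bar>x $ j\<bar>" if "x \<in> cube x0 (d k)" for x k
  proof -
    have "\<bar>x $ j - x0 $ j\<bar> \<le> c" using that d(2)[of k] by (auto simp: mem_cube intro: order_trans)
    then show ?thesis unfolding c_def by linarith
  qed
  have cube0: "cube x0 (d k) \<subseteq> - {0}" for k using far[of 0 k] c by auto
  have contK: "continuous_on (- {0}) K0" and test: "\<And>f. f \<in> test_functions (- {0}) \<Longrightarrow> K0_distr f = regular_distr K0 f"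
    using K0 by (auto simp: restricts_to_continuous_def)
  define I where "I k = (LINT x|lborel. pulse_prod (d k) x0 x)" for k
  have mp: "complex_of_real (mean_pulse (d k) x0 x) = complex_of_real (pulse_prod (d k) x0 x) / complex_of_real (I k)" for k x
    by (simp add: mean_pulse_def I_def)
  have eq: "(LINT x|lborel. K0 x * complex_of_real (mean_pulse (d k) x0 x)) =
     (LINT t:{0<..}|lborel. LINT x|lborel. heat_slice one t 1 x * complex_of_real (mean_pulse (d k) x0 x))" for k
  proof -
    have "(LINT x|lborel. K0 x * complex_of_real (pulse_prod (d k) x0 x)) = K0_distr (\<lambda>x. complex_of_real (pulse_prod (d k) x0 x))"
      using test[OF pulse_prod_test_function[OF d(1)]] cube0[of k] by (simp add: regular_distr_def cube_def)
    also have "\<dots> = distr_fourier K0_distr (wave_prod (d k) x0)"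
      unfolding distr_fourier_def fourier_wave_prod[OF d(1)] ..
    also have "\<dots> = regular_distr (\<lambda>\<xi>. complex_of_real (K0_hat one \<xi>)) (wave_prod (d k) x0)"
      using T wave_prod_schwartz[OF d(1)] by blast
    also have "\<dots> = (LINT t:{0<..}|lborel. LINT x|lborel. heat_slice one t 1 x * complex_of_real (pulse_prod (d k) x0 x))"
      by (rule K0_hat_pairing[OF d(1)])
    finally have *: "(LINT x|lborel. K0 x * complex_of_real (pulse_prod (d k) x0 x)) = \<dots>" .
    show ?thesis
      unfolding mp times_divide_eq_right integral_divide_zero set_integral_divide_zero * ..
  qed
  have "(\<lambda>k. LINT x|lborel. K0 x * complex_of_real (mean_pulse (d k) x0 x)) \<longlonglongrightarrow> K0 x0"
  proof (rule mean_pulse_tendsto[OF d(1) d0])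
    show "continuous_on (cube x0 (d k)) K0" for k by (rule continuous_on_subset[OF contK cube0])
    show "isCont K0 x0" using contK x0 continuous_on_eq_continuous_at[of "- {0}" K0] by (simp add: open_Compl)
  qed
  moreover have "(\<lambda>k. LINT t:{0<..}|lborel. LINT x|lborel. heat_slice one t 1 x * complex_of_real (mean_pulse (d k) x0 x))
     \<longlonglongrightarrow> (LINT t:{0<..}|lborel. heat_slice one t 1 x0)"
    unfolding set_lebesgue_integral_def
  proof -
    obtain C where C: "\<And>t e (x::real^'n). 0 < t \<and> 0 \<le> e \<and> e \<le> 1 \<and> (\<exists>i. c \<le> \<bar>x $ i\<bar>) \<Longrightarrow>
       norm (heat_slice one t e x) \<le> C / (1 + t\<^sup>2)"
      using heat_slice_bound[OF N c, of one] by blast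
    have cont: "continuous_on A (heat_slice one t 1)" if "t > 0" for A t
      by (intro continuous_at_imp_continuous_on ballI isCont_heat_slice that) simp
    show "(\<lambda>k. LINT t|lborel. indicator {0<..} t *\<^sub>R (LINT x|lborel. heat_slice one t 1 x * complex_of_real (mean_pulse (d k) x0 x)))
       \<longlonglongrightarrow> (LINT t|lborel. indicator {0<..} t *\<^sub>R heat_slice one t 1 x0)"
    proof (rule integral_dominated_convergence[where w="\<lambda>t. indicator {0<..} t *\<^sub>R (C / (1 + t\<^sup>2))"])
      have [measurable]: "mean_pulse (d k) x0 \<in> borel_measurable borel" for k
        using borel_measurable_integrable[OF integrable_mean_pulse[OF d(1)]] by simp
      show "(\<lambda>t. indicator {0<..} t *\<^sub>R heat_slice one t 1 x0) \<in> borel_measurable lborel" by measurable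
      show "(\<lambda>t. indicator {0<..} t *\<^sub>R (LINT x|lborel. heat_slice one t 1 x * complex_of_real (mean_pulse (d k) x0 x))) \<in> borel_measurable lborel" for k
        by measurable
      show "integrable lborel (\<lambda>t::real. indicator {0<..} t *\<^sub>R (C / (1 + t\<^sup>2)))"
        using set_integrable_one_plus_square[of C] by (simp only: set_integrable_def)
      show "AE t in lborel. (\<lambda>k. indicator {0<..} t *\<^sub>R (LINT x|lborel. heat_slice one t 1 x * complex_of_real (mean_pulse (d k) x0 x)))
           \<longlonglongrightarrow> indicator {0<..} t *\<^sub>R heat_slice one t 1 x0"
      proof (intro AE_I2)
        fix t :: real
        show "(\<lambda>k. indicator {0<..} t *\<^sub>R (LINT x|lborel. heat_slice one t 1 x * complex_of_real (mean_pulse (d k) x0 x)))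
           \<longlonglongrightarrow> indicator {0<..} t *\<^sub>R heat_slice one t 1 x0"
        proof (cases "t > 0")
          case True
          then show ?thesis
            by (intro tendsto_intros mean_pulse_tendsto[OF d(1) d0] cont isCont_heat_slice) auto
        qed simp
      qed
      show "AE t in lborel. norm (indicator {0<..} t *\<^sub>R (LINT x|lborel. heat_slice one t 1 x * complex_of_real (mean_pulse (d k) x0 x)))
          \<le> indicator {0<..} t *\<^sub>R (C / (1 + t\<^sup>2))" for k
      proof (intro AE_I2)
        fix t :: real
        show "norm (indicator {0<..} t *\<^sub>R (LINT x|lborel. heat_slice one t 1 x * complex_of_real (mean_pulse (d k) x0 x)))
          \<le> indicator {0<..} t *\<^sub>R (C / (1 + t\<^sup>2))"
        proof (cases "t > 0")
          case True
          have "norm (LINT x|lborel. heat_slice one t 1 x * complex_of_real (mean_pulse (d k) x0 x))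
             \<le> (LINT x|lborel. norm (heat_slice one t 1 x * complex_of_real (mean_pulse (d k) x0 x)))"
            by (rule integral_norm_bound)
          also have "\<dots> \<le> (LINT x|lborel. (C / (1 + t\<^sup>2)) * mean_pulse (d k) x0 x)"
          proof (rule integral_mono)
            show "integrable lborel (\<lambda>x. norm (heat_slice one t 1 x * complex_of_real (mean_pulse (d k) x0 x)))"
              by (intro integrable_norm integrable_mult_mean_pulse d cont True)
            show "integrable lborel (\<lambda>x. (C / (1 + t\<^sup>2)) * mean_pulse (d k) x0 x)"
              by (intro integrable_mult_right integrable_mean_pulse d)
            fix x
            show "norm (heat_slice one t 1 x * complex_of_real (mean_pulse (d k) x0 x)) \<le> (C / (1 + t\<^sup>2)) * mean_pulse (d k) x0 x"
            proof (cases "x \<in> cube x0 (d k)")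
              case xc: True
              have "norm (heat_slice one t 1 x) \<le> C / (1 + t\<^sup>2)" using far[OF xc] True by (intro C) auto
              then show ?thesis
                using mean_pulse_nonneg[of "d k" x0 x] by (simp add: norm_mult mult_right_mono del: times_divide_eq_left)
            qed (simp add: mean_pulse_def pulse_prod_outside_cube[OF d(1)])
          qed
          also have "\<dots> = C / (1 + t\<^sup>2)" by (simp add: integral_mean_pulse[OF d(1)])
          finally show ?thesis using True by simp
        qed simp
      qed
    qed
  qed
  ultimately show ?thesis unfolding eq by (rule LIMSEQ_unique)
qed

section \<open>Rescaling and the limit at infinity\<close>

text \<open>The substitution $v = 1/(4t)$ turns the integral into Euler's integral for the Gamma function.\<close>
lemma inverse_gamma_integral:
  fixes s :: real
  assumes s: "s > 0"
  shows "has_bochner_integral lborel (\<lambda>t. indicator {0<..} t *\<^sub>R (t powr (- s - 1) * exp (- (1 / (4 * t))))) (4 powr s * Gamma s)"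
proof -
  define f where "f v = v powr (s - 1) / exp v" for v :: real
  define g where "g t = 1 / (4 * t)" for t :: real
  define g' where "g' t = - (1 / (4 * t\<^sup>2))" for t :: real
  let ?F = "\<lambda>t. t powr (- s - 1) * exp (- (1 / (4 * t)))"
  have f1: "(f has_integral Gamma s) {0<..}"
  proof -
    have "((\<lambda>v. if v \<in> {0<..} then f v else 0) has_integral Gamma s) {0..}"
      by (rule has_integral_spike[of "{0}", OF _ _ Gamma_integral_real[OF s]]) (auto simp: f_def)
    then show ?thesis by (subst (asm) has_integral_restrict) auto
  qed
  then have f2: "f absolutely_integrable_on {0<..}"
    by (intro nonnegative_absolutely_integrable_1) (auto simp: f_def)
  have img: "g ` {0<..} = {0<..}"
  proof -
    have "v \<in> g ` {0<..}" if "v > 0" for v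
      by (rule image_eqI[of _ _ "1 / (4 * v)"]) (use that in \<open>auto simp: g_def\<close>)
    then show ?thesis by (auto simp: g_def)
  qed
  have "(g has_field_derivative g' t) (at t within {0<..})" if "t \<in> {0<..}" for t
    unfolding g_def g'_def using that
    by (auto intro!: derivative_eq_intros simp: power2_eq_square field_simps)
  moreover have "inj_on g {0<..}" by (auto simp: inj_on_def g_def)
  moreover have "f absolutely_integrable_on g ` {0<..} \<and> integral (g ` {0<..}) f = Gamma s"
    unfolding img using f1 f2 by (simp add: integral_unique)
  ultimately have "(\<lambda>t. \<bar>g' t\<bar> * f (g t)) absolutely_integrable_on {0<..} \<and> integral {0<..} (\<lambda>t. \<bar>g' t\<bar> * f (g t)) = Gamma s"
    using has_absolute_integral_change_of_variables_1'[of "{0<..}" g g' f "Gamma s"] by simp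
  moreover have eq: "\<bar>g' t\<bar> * f (g t) = 4 powr (- s) * ?F t" if "t \<in> {0<..}" for t
  proof -
    have t: "t > 0" using that by simp
    have "\<bar>g' t\<bar> * f (g t) = (1 / (4 * t\<^sup>2)) * (4 * t) powr (1 - s) * exp (- (1 / (4 * t)))"
      using t powr_minus_divide[of "4 * t" "s - 1"] by (simp add: g'_def g_def f_def powr_divide exp_minus field_simps)
    also have "(1 / (4 * t\<^sup>2)) * (4 * t) powr (1 - s) = 4 powr (- s) * t powr (- s - 1)"
    proof -
      have p4: "4 powr (- s) = 4 powr (1 - s) / 4" using powr_add[of 4 "- s" 1] by (simp add: field_simps)
      have pt: "t powr (- s - 1) = t powr (1 - s) / t\<^sup>2"
      proof -
        have e: "- s - 1 = (1 - s) - 2" by simp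
        show ?thesis unfolding e powr_diff using t by (simp add: powr_numeral)
      qed
      show ?thesis unfolding p4 pt using t by (simp add: powr_mult)
    qed
    finally show ?thesis by simp
  qed
  ultimately have ai: "(\<lambda>t. 4 powr (- s) * ?F t) absolutely_integrable_on {0<..}"
    and iv: "integral {0<..} (\<lambda>t. 4 powr (- s) * ?F t) = Gamma s"
    using absolutely_integrable_spike_eq[of "{}" "{0<..}" "\<lambda>t. \<bar>g' t\<bar> * f (g t)" "\<lambda>t. 4 powr (- s) * ?F t"]
      integral_cong[of "{0<..}" "\<lambda>t. \<bar>g' t\<bar> * f (g t)" "\<lambda>t. 4 powr (- s) * ?F t", OF eq]
    by (auto simp del: integral_mult_right)
  have m: "(\<lambda>t. indicator {0<..} t *\<^sub>R (4 powr (- s) * ?F t)) \<in> borel_measurable lborel" by measurable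
  have "integrable lborel (\<lambda>t. indicator {0<..} t *\<^sub>R (4 powr (- s) * ?F t))"
    using ai integrable_completion[OF m] by (simp add: set_integrable_def)
  moreover have "(LINT t|lborel. indicator {0<..} t *\<^sub>R (4 powr (- s) * ?F t)) = Gamma s"
    using set_lebesgue_integral_eq_integral(2)[OF ai] iv
    by (simp only: set_lebesgue_integral_def integral_completion[OF m])
  ultimately have "has_bochner_integral lborel (\<lambda>t. indicator {0<..} t *\<^sub>R (4 powr (- s) * ?F t)) (Gamma s)"
    by (simp add: has_bochner_integral_iff)
  from has_bochner_integral_mult_right[OF this, of "4 powr s"]
  show ?thesis by (simp add: powr_minus field_simps)
qed

lemma heat_slice_scale:
  fixes x :: "real^'n::finite"
  assumes R: "R > 0"
  shows "heat_slice one (R\<^sup>2 * t) 1 x = complex_of_real ((1 / R) ^ (CARD('n) + 2)) * heat_slice one t (1 / R\<^sup>2) ((1 / R) *\<^sub>R x)"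
proof -
  have "heat_slice one (R\<^sup>2 * t) 1 x =
    (\<Prod>i\<in>UNIV. (complex_of_real (1 / R) * (if i = one then complex_of_real ((1 / R)\<^sup>2) else 1)) *
      (osc_integral (if i = one then 2 else 0) t (if i = one then t * (1 / R\<^sup>2) else 0) (((1 / R) *\<^sub>R x) $ i) / (2 * pi)))"
    unfolding heat_slice_def
  proof (intro prod.cong refl)
    fix i
    have 2: "R\<^sup>2 * t * (1 / R)\<^sup>2 = t" using R by (simp add: power_divide)
    have 4: "R\<^sup>2 * t * 1 * (1 / R) ^ 4 = t * (1 / R\<^sup>2)" using R by (simp add: power_divide field_simps)
    show "osc_integral (if i = one then 2 else 0) (R\<^sup>2 * t) (if i = one then R\<^sup>2 * t * 1 else 0) (x $ i) / (2 * pi) =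
      (complex_of_real (1 / R) * (if i = one then complex_of_real ((1 / R)\<^sup>2) else 1)) *
      (osc_integral (if i = one then 2 else 0) t (if i = one then t * (1 / R\<^sup>2) else 0) (((1 / R) *\<^sub>R x) $ i) / (2 * pi))"
    proof (cases "i = one")
      case True
      have "osc_integral 2 (R\<^sup>2 * t) (R\<^sup>2 * t * 1) (x $ i) = complex_of_real ((1 / R) ^ Suc 2) * osc_integral 2 t (t * (1 / R\<^sup>2)) (1 / R * x $ i)"
        using osc_integral_scale[of "1 / R" 2 "R\<^sup>2 * t" "R\<^sup>2 * t * 1" "x $ i"] R unfolding 2 4 by simp
      then show ?thesis using True by (simp add: power3_eq_cube power2_eq_square)
    next
      case False
      have "osc_integral 0 (R\<^sup>2 * t) 0 (x $ i) = complex_of_real ((1 / R) ^ Suc 0) * osc_integral 0 t 0 (1 / R * x $ i)"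
        using osc_integral_scale[of "1 / R" 0 "R\<^sup>2 * t" 0 "x $ i"] R unfolding 2 by simp
      then show ?thesis using False by simp
    qed
  qed
  also have "\<dots> = complex_of_real ((1 / R) ^ (CARD('n) + 2)) * heat_slice one t (1 / R\<^sup>2) ((1 / R) *\<^sub>R x)"
    unfolding heat_slice_def prod.distrib by (simp add: power_add power2_eq_square)
  finally show ?thesis .
qed

lemma heat_slice_0:
  fixes x :: "real^'n::finite"
  assumes t: "t > 0" and x: "norm x = 1"
  shows "heat_slice one t 0 x = complex_of_real ((4 * pi) powr (- (CARD('n) / 2)) *
    (t powr (- (CARD('n) / 2)) * exp (- (1 / (4 * t))) * (1 / (2 * t) - (x $ one)\<^sup>2 / (4 * t\<^sup>2))))"
proof -
  define q where "q = (4 * pi * t) powr (- 1 / 2)"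
  have q: "sqrt (pi / t) / (2 * pi) = q"
  proof -
    have "q = 1 / sqrt (4 * pi * t)" using t by (simp add: q_def powr_minus_divide powr_half_sqrt)
    also have "\<dots> = sqrt (pi / t) / (2 * pi)"
      using t by (simp add: real_sqrt_mult real_sqrt_divide field_simps)
    finally show ?thesis by simp
  qed
  have "heat_slice one t 0 x = (\<Prod>i\<in>UNIV. (if i = one then complex_of_real (1 / (2 * t) - (x $ one)\<^sup>2 / (4 * t\<^sup>2)) else 1)
     * (complex_of_real q * complex_of_real (exp (- ((x $ i)\<^sup>2 / (4 * t))))))"
    unfolding heat_slice_def
  proof (intro prod.cong refl)
    fix i
    have o: "osc_integral 0 t 0 (x $ i) / (2 * pi) = complex_of_real q * complex_of_real (exp (- ((x $ i)\<^sup>2 / (4 * t))))"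
      by (simp add: osc_integral_0_gauss[OF t] flip: q)
    show "osc_integral (if i = one then 2 else 0) t (if i = one then t * 0 else 0) (x $ i) / (2 * pi) =
      (if i = one then complex_of_real (1 / (2 * t) - (x $ one)\<^sup>2 / (4 * t\<^sup>2)) else 1)
     * (complex_of_real q * complex_of_real (exp (- ((x $ i)\<^sup>2 / (4 * t)))))"
    proof (cases "i = one")
      case True
      have "osc_integral 2 t 0 (x $ one) / (2 * pi) = complex_of_real (1 / (2 * t) - (x $ one)\<^sup>2 / (4 * t\<^sup>2)) * (osc_integral 0 t 0 (x $ one) / (2 * pi))"
        by (simp only: osc_integral_2_gauss[OF t] times_divide_eq_right)
      also note o[unfolded True]
      finally show ?thesis using True by (simp only: if_True mult_zero_right simp_thms)
    qed (use o in simp)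
  qed
  also have "\<dots> = complex_of_real ((1 / (2 * t) - (x $ one)\<^sup>2 / (4 * t\<^sup>2)) * (q ^ CARD('n) * (\<Prod>i\<in>UNIV. exp (- ((x $ i)\<^sup>2 / (4 * t))))))"
    by (simp add: prod.distrib)
  also have "(\<Prod>i\<in>UNIV. exp (- ((x $ i)\<^sup>2 / (4 * t)))) = exp (\<Sum>i\<in>UNIV. - ((x $ i)\<^sup>2 / (4 * t)))"
    by (simp add: exp_sum)
  also have "(\<Sum>i\<in>UNIV. - ((x $ i)\<^sup>2 / (4 * t))) = - (1 / (4 * t))"
  proof -
    have "(\<Sum>i\<in>UNIV. (x $ i)\<^sup>2) = (norm x)\<^sup>2" by (simp add: norm_vec_def L2_set_def sum_nonneg)
    then show ?thesis using x by (simp add: sum_negf flip: sum_divide_distrib)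
  qed
  also have "q ^ CARD('n) = (4 * pi) powr (- (CARD('n) / 2)) * t powr (- (CARD('n) / 2))"
  proof -
    have "q ^ CARD('n) = (4 * pi * t) powr (- (CARD('n) / 2))"
      unfolding q_def using t by (subst powr_power) simp_all
    also have "\<dots> = (4 * pi) powr (- (CARD('n) / 2)) * t powr (- (CARD('n) / 2))"
      by (rule powr_mult)
    finally show ?thesis .
  qed
  finally show ?thesis by (simp add: mult_ac)
qed

text \<open>With $s = N/2$ the two terms are inverse Gamma integrals with parameters $s$ and $s+1$, and
  $\Gamma(s+1) = s\Gamma(s)$ combines them.\<close>
lemma integral_heat_slice_0:
  fixes x :: "real^'n::finite"
  assumes x: "norm x = 1"
  shows "(LINT t:{0<..}|lborel. heat_slice one t 0 x) =
     complex_of_real (Gamma (CARD('n) / 2) / (2 * pi powr (CARD('n) / 2)) * (1 - CARD('n) * (x $ one)\<^sup>2))"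
proof -
  define s where "s = real CARD('n) / 2"
  have s: "s > 0" by (simp add: s_def)
  define F where "F u t = indicator {0<..} t *\<^sub>R (t powr (- u - 1) * exp (- (1 / (4 * t))))" for u t :: real
  have F: "has_bochner_integral lborel (F u) (4 powr u * Gamma u)" if "u > 0" for u
    unfolding F_def[abs_def] by (rule inverse_gamma_integral[OF that])
  have "indicator {0<..} t *\<^sub>R heat_slice one t 0 x =
     complex_of_real ((4 * pi) powr (- s) * (1 / 2 * F s t - (x $ one)\<^sup>2 / 4 * F (s + 1) t))" for t
  proof (cases "t > 0")
    case True
    have p1: "t powr (- s) * (1 / (2 * t)) = 1 / 2 * t powr (- s - 1)"
      using True powr_diff[of t "- s" 1] by simp
    have p2: "t powr (- s) * (1 / (4 * t\<^sup>2)) = 1 / 4 * t powr (- (s + 1) - 1)"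
    proof -
      have e: "- (s + 1) - 1 = - s - 2" by simp
      show ?thesis unfolding e using True powr_diff[of t "- s" 2] by (simp add: powr_numeral)
    qed
    have "heat_slice one t 0 x = complex_of_real ((4 * pi) powr (- s) * ((t powr (- s) * (1 / (2 * t))) * exp (- (1 / (4 * t)))
       - (x $ one)\<^sup>2 * (t powr (- s) * (1 / (4 * t\<^sup>2))) * exp (- (1 / (4 * t)))))"
      unfolding heat_slice_0[OF True x] s_def by (simp add: algebra_simps)
    then show ?thesis unfolding p1 p2 F_def using True by (simp add: mult_ac)
  qed (simp add: F_def)
  moreover have "has_bochner_integral lborel (\<lambda>t. (4 * pi) powr (- s) * (1 / 2 * F s t - (x $ one)\<^sup>2 / 4 * F (s + 1) t))
     ((4 * pi) powr (- s) * (1 / 2 * (4 powr s * Gamma s) - (x $ one)\<^sup>2 / 4 * (4 powr (s + 1) * Gamma (s + 1))))"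
    by (intro has_bochner_integral_mult_right has_bochner_integral_diff F) (use s in auto)
  ultimately have "(LINT t:{0<..}|lborel. heat_slice one t 0 x) =
     complex_of_real ((4 * pi) powr (- s) * (1 / 2 * (4 powr s * Gamma s) - (x $ one)\<^sup>2 / 4 * (4 powr (s + 1) * Gamma (s + 1))))"
    unfolding set_lebesgue_integral_def by (simp only: integral_complex_of_real has_bochner_integral_integral_eq)
  also have "Gamma (s + 1) = s * Gamma s" using s by (intro Gamma_plus1) (auto simp: nonpos_Ints_def)
  also have "(4 * pi) powr (- s) * (1 / 2 * (4 powr s * Gamma s) - (x $ one)\<^sup>2 / 4 * (4 powr (s + 1) * (s * Gamma s))) =
     Gamma s / (2 * pi powr s) * (1 - 2 * s * (x $ one)\<^sup>2)"
    by (simp add: powr_mult powr_minus powr_add field_simps)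
  finally show ?thesis by (simp add: s_def)
qed

theorem theorem5:
  fixes one :: "'n::finite"
    and K0_distr :: "(real^'n \<Rightarrow> complex) \<Rightarrow> complex"
    and K0 :: "real^'n \<Rightarrow> complex"
    and \<sigma> y :: "real^'n"
  assumes "CARD('n) \<ge> 2"
    and "tempered_distribution K0_distr"
    and "\<forall>f\<in>schwartz_space.
           distr_fourier K0_distr f = regular_distr (\<lambda>\<xi>. complex_of_real (K0_hat one \<xi>)) f"
    and "restricts_to_continuous K0_distr (- {0}) K0"
    and "\<sigma> \<in> sphere 0 1"
  shows "((\<lambda>R::real. complex_of_real (R ^ CARD('n)) * K0 (R *\<^sub>R \<sigma> - y)) \<longlongrightarrow>
           complex_of_real (Gamma (real CARD('n) / 2) / (2 * pi powr (real CARD('n) / 2))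
             * (1 - real CARD('n) * (\<sigma> $ one)\<^sup>2))) at_top"
proof -
  have \<sigma>: "norm \<sigma> = 1" using assms(5) by simp
  define z where "z R = \<sigma> - (1 / R) *\<^sub>R y" for R :: real
  have z: "(z \<longlongrightarrow> \<sigma>) at_top"
  proof -
    have "((\<lambda>R::real. 1 / R) \<longlongrightarrow> 0) at_top" by real_asymp
    from tendsto_diff[OF tendsto_const tendsto_scaleR[OF this tendsto_const]]
    show ?thesis unfolding z_def[abs_def] by fastforce
  qed
  obtain j where j: "\<sigma> $ j \<noteq> 0" using \<sigma> by (metis norm_zero vec_eq_iff zero_index zero_neq_one)
  \<comment> \<open>as $R\sigma - y$ is divided by $R$, the shift $y$ becomes negligible and the $j$-th coordinate eventually exceeds $c$\<close>
  define c where "c = \<bar>\<sigma> $ j\<bar> / 2"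
  have c: "c > 0" using j by (simp add: c_def)
  have far: "\<forall>\<^sub>F R in at_top. c \<le> \<bar>z R $ j\<bar>"
  proof -
    have "((\<lambda>R. \<bar>z R $ j\<bar>) \<longlongrightarrow> \<bar>\<sigma> $ j\<bar>) at_top" by (intro tendsto_intros z)
    moreover have "c < \<bar>\<sigma> $ j\<bar>" using c by (simp add: c_def)
    ultimately have "\<forall>\<^sub>F R in at_top. c < \<bar>z R $ j\<bar>" by (rule order_tendstoD(1))
    then show ?thesis by eventually_elim simp
  qed
  obtain C where C: "\<And>t e (x::real^'n). 0 < t \<and> 0 \<le> e \<and> e \<le> 1 \<and> (\<exists>i. c \<le> \<bar>x $ i\<bar>) \<Longrightarrow>
       norm (heat_slice one t e x) \<le> C / (1 + t\<^sup>2)"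
    using heat_slice_bound[OF assms(1) c, of one] by blast
  have "((\<lambda>R. LINT t|lborel. indicator {0<..} t *\<^sub>R heat_slice one t (1 / R\<^sup>2) (z R)) \<longlongrightarrow>
      (LINT t|lborel. indicator {0<..} t *\<^sub>R heat_slice one t 0 \<sigma>)) at_top"
  proof (rule integral_dominated_convergence_at_top[where w="\<lambda>t. indicator {0<..} t *\<^sub>R (C / (1 + t\<^sup>2))"])
    show "integrable lborel (\<lambda>t::real. indicator {0<..} t *\<^sub>R (C / (1 + t\<^sup>2)))"
      using set_integrable_one_plus_square[of C] by (simp only: set_integrable_def)
    show "AE t in lborel. ((\<lambda>R. indicator {0<..} t *\<^sub>R heat_slice one t (1 / R\<^sup>2) (z R)) \<longlongrightarrow> indicator {0<..} t *\<^sub>R heat_slice one t 0 \<sigma>) at_top"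
    proof (intro AE_I2)
      fix t :: real
      show "((\<lambda>R. indicator {0<..} t *\<^sub>R heat_slice one t (1 / R\<^sup>2) (z R)) \<longlongrightarrow> indicator {0<..} t *\<^sub>R heat_slice one t 0 \<sigma>) at_top"
      proof (cases "t > 0")
        case True
        have "((\<lambda>R. heat_slice one t (1 / R\<^sup>2) (z R)) \<longlongrightarrow> heat_slice one t 0 \<sigma>) at_top"
        proof (rule tendsto_at_topI_sequentially)
          fix X :: "nat \<Rightarrow> real" assume X: "filterlim X at_top sequentially"
          have "((\<lambda>R::real. 1 / R\<^sup>2) \<longlongrightarrow> 0) at_top" by real_asymp
          then have "(\<lambda>k. 1 / (X k)\<^sup>2) \<longlonglongrightarrow> 0" using X by (rule filterlim_compose)
          then show "(\<lambda>k. heat_slice one t (1 / (X k)\<^sup>2) (z (X k))) \<longlonglongrightarrow> heat_slice one t 0 \<sigma>"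
            by (intro heat_slice_tendsto True filterlim_compose[OF z X]) auto
        qed
        then show ?thesis by (intro tendsto_intros)
      qed simp
    qed
    show "\<forall>\<^sub>F R in at_top. AE t in lborel. norm (indicator {0<..} t *\<^sub>R heat_slice one t (1 / R\<^sup>2) (z R)) \<le> indicator {0<..} t *\<^sub>R (C / (1 + t\<^sup>2))"
      using far eventually_ge_at_top[of "1::real"]
    proof eventually_elim
      case (elim R)
      have R: "1 / R\<^sup>2 \<le> 1" using elim(2) by (simp add: one_le_power)
      show ?case
      proof (intro AE_I2)
        fix t :: real
        show "norm (indicator {0<..} t *\<^sub>R heat_slice one t (1 / R\<^sup>2) (z R)) \<le> indicator {0<..} t *\<^sub>R (C / (1 + t\<^sup>2))"
          using C[of t "1 / R\<^sup>2" "z R"] R elim(1) by (cases "t > 0") auto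
      qed
    qed
  qed measurable
  also have "(LINT t|lborel. indicator {0<..} t *\<^sub>R heat_slice one t 0 \<sigma>) =
      complex_of_real (Gamma (real CARD('n) / 2) / (2 * pi powr (real CARD('n) / 2)) * (1 - real CARD('n) * (\<sigma> $ one)\<^sup>2))"
    using integral_heat_slice_0[OF \<sigma>, of one] by (simp only: set_lebesgue_integral_def)
  finally have lim: "((\<lambda>R. LINT t|lborel. indicator {0<..} t *\<^sub>R heat_slice one t (1 / R\<^sup>2) (z R)) \<longlongrightarrow>
      complex_of_real (Gamma (real CARD('n) / 2) / (2 * pi powr (real CARD('n) / 2)) * (1 - real CARD('n) * (\<sigma> $ one)\<^sup>2))) at_top" .
  have "\<forall>\<^sub>F R in at_top. (LINT t|lborel. indicator {0<..} t *\<^sub>R heat_slice one t (1 / R\<^sup>2) (z R)) =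
     complex_of_real (R ^ CARD('n)) * K0 (R *\<^sub>R \<sigma> - y)"
    using far eventually_gt_at_top[of "0::real"]
  proof eventually_elim
    case (elim R)
    define x where "x = R *\<^sub>R \<sigma> - y"
    have xz: "(1 / R) *\<^sub>R x = z R" using elim(2) by (simp add: x_def z_def algebra_simps)
    have "x \<noteq> 0" using xz elim(1) c by auto
    then have "K0 x = (LINT t:{0<..}|lborel. heat_slice one t 1 x)"
      using K0_eq_integral_heat_slice[OF assms(1,3,4)] by blast
    also have "\<dots> = R\<^sup>2 *\<^sub>R (LINT t|lborel. indicator {0<..} (0 + R\<^sup>2 * t) *\<^sub>R heat_slice one (0 + R\<^sup>2 * t) 1 x)"
      unfolding set_lebesgue_integral_def using elim(2) by (subst lborel_integral_real_affine[of "R\<^sup>2" _ 0]) auto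
    also have "(\<lambda>t. indicator {0<..} (0 + R\<^sup>2 * t) *\<^sub>R heat_slice one (0 + R\<^sup>2 * t) 1 x) =
       (\<lambda>t. complex_of_real ((1 / R) ^ (CARD('n) + 2)) * (indicator {0<..} t *\<^sub>R heat_slice one t (1 / R\<^sup>2) (z R)))"
    proof
      fix t
      have "indicator {0<..} (0 + R\<^sup>2 * t) = (indicator {0<..} t :: real)"
        using elim(2) by (simp add: indicator_def zero_less_mult_iff)
      then show "indicator {0<..} (0 + R\<^sup>2 * t) *\<^sub>R heat_slice one (0 + R\<^sup>2 * t) 1 x =
         complex_of_real ((1 / R) ^ (CARD('n) + 2)) * (indicator {0<..} t *\<^sub>R heat_slice one t (1 / R\<^sup>2) (z R))"
        using heat_slice_scale[OF elim(2), of one t x] by (simp add: xz)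
    qed
    finally have "K0 x = R\<^sup>2 *\<^sub>R (complex_of_real ((1 / R) ^ (CARD('n) + 2)) * (LINT t|lborel. indicator {0<..} t *\<^sub>R heat_slice one t (1 / R\<^sup>2) (z R)))"
      by (simp only: integral_mult_right_zero)
    then have "complex_of_real (R ^ CARD('n)) * K0 x =
       complex_of_real (R ^ CARD('n) * R\<^sup>2 * (1 / R) ^ (CARD('n) + 2)) * (LINT t|lborel. indicator {0<..} t *\<^sub>R heat_slice one t (1 / R\<^sup>2) (z R))"
      by (simp only: scaleR_conv_of_real of_real_mult mult.assoc)
    also have "R ^ CARD('n) * R\<^sup>2 * (1 / R) ^ (CARD('n) + 2) = 1"
      using elim(2) by (simp add: power_one_over flip: power_add)
    finally show ?case by (simp add: x_def)
  qed
  with lim show ?thesis by (rule Lim_transform_eventually)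
qed

end
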